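(* $\mathsf{AVG}_\tau\text{-}\mathsf{LCL}[O(1)]\subseteq\mathsf{BPP}$.
   Context: A catalytic-type machine has a read-only input tape, a write-only output tape, a read-write work tape and a read-write catalytic tape initially holding an arbitrary string $\tau$. Let $d$ denote Hamming distance. $\mathsf{AVG}_\tau\text{-}\mathsf{LCL}[O(1)]$ is the class of languages $L$ for which there are constants $k,e$ and a deterministic such machine with $k\log n$ work bits and $n^k$ catalytic bits that, on every input $x$ and every initial catalytic content $\tau\in\{0,1\}^{n^k}$, outputs $L(x)$, and whose final catalytic content $\tau'$ satisfies $\mathbb{E}_\tau[d(\tau,\tau')]\le e$ for $\tau$ uniform (for every $x$). No time bound is imposed on the machine. *)

theory Defs
  imports Complex_Main
begin

text \<open>A deterministic machine with finitely many states 0..<nstates (start state 0),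
  a two-way read-only binary input tape with end-markers (cells 0 and n+1 hold the
  end-marker None, cell i holds the i-th input bit), a read-write binary work tape of
  fixed length, a second read-write binary tape of fixed length (the catalytic tape,
  resp. the random tape for BPP), and a write-only output tape (a list to which bits are
  appended).  Heads move by at most one cell per step (the sign of the move component
  is used) and are clamped to the tape boundaries.\<close>

record machine =
  nstates :: nat
  delta :: "nat \<Rightarrow> bool option \<Rightarrow> bool \<Rightarrow> bool \<Rightarrow>
             (nat \<times> int \<times> bool \<times> int \<times> bool \<times> int \<times> bool option)"
  halting :: "nat \<Rightarrow> bool"

text \<open>delta q a w c = (q', input move, work bit written, work move,
  catalytic bit written, catalytic move, output bit (if any))\<close>

definition wf_machine :: "machine \<Rightarrow> bool" where
  "wf_machine M \<longleftrightarrow> 0 < nstates M \<and>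
     (\<forall>q a w c. q < nstates M \<longrightarrow> fst (delta M q a w c) < nstates M)"

type_synonym config = "nat \<times> nat \<times> bool list \<times> nat \<times> bool list \<times> nat \<times> bool list"
  (* state, input head, work tape, work head, aux tape, aux head, output tape *)

definition rd :: "bool list \<Rightarrow> nat \<Rightarrow> bool" where
  "rd xs j = (j < length xs \<and> xs ! j)"

definition insym :: "bool list \<Rightarrow> nat \<Rightarrow> bool option" where
  "insym x i = (if 1 \<le> i \<and> i \<le> length x then Some (x ! (i - 1)) else None)"

definition mv :: "nat \<Rightarrow> int \<Rightarrow> nat \<Rightarrow> nat" where
  "mv p d b = nat (min (int b) (max 0 (int p + sgn d)))"

definition step :: "machine \<Rightarrow> bool list \<Rightarrow> config \<Rightarrow> config" where
  "step M x cf = (case cf of (q, i, w, wh, c, ch, out) \<Rightarrow>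
     if halting M q then cf else
     (case delta M q (insym x i) (rd w wh) (rd c ch) of (q', di, ww, dw, cw, dc, ob) \<Rightarrow>
        (q', mv i di (length x + 1),
         w[wh := ww], mv wh dw (length w - 1),
         c[ch := cw], mv ch dc (length c - 1),
         (case ob of None \<Rightarrow> out | Some b \<Rightarrow> out @ [b]))))"

definition init_config :: "nat \<Rightarrow> bool list \<Rightarrow> config" where
  "init_config wlen aux = (0, 0, replicate wlen False, 0, aux, 0, [])"

definition run :: "machine \<Rightarrow> bool list \<Rightarrow> nat \<Rightarrow> bool list \<Rightarrow> nat \<Rightarrow> config" where
  "run M x wlen aux t = (step M x ^^ t) (init_config wlen aux)"

definition cstate :: "config \<Rightarrow> nat" where "cstate cf = fst cf"
definition caux :: "config \<Rightarrow> bool list" where "caux cf = fst (snd (snd (snd (snd cf))))"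
definition cout :: "config \<Rightarrow> bool list" where "cout cf = snd (snd (snd (snd (snd (snd cf)))))"

definition halts_within :: "machine \<Rightarrow> bool list \<Rightarrow> nat \<Rightarrow> bool list \<Rightarrow> nat \<Rightarrow> bool" where
  "halts_within M x wlen aux T \<longleftrightarrow> (\<exists>t\<le>T. halting M (cstate (run M x wlen aux t)))"

definition halts :: "machine \<Rightarrow> bool list \<Rightarrow> nat \<Rightarrow> bool list \<Rightarrow> bool" where
  "halts M x wlen aux \<longleftrightarrow> (\<exists>t. halting M (cstate (run M x wlen aux t)))"

definition final :: "machine \<Rightarrow> bool list \<Rightarrow> nat \<Rightarrow> bool list \<Rightarrow> config" where
  "final M x wlen aux = run M x wlen aux (LEAST t. halting M (cstate (run M x wlen aux t)))"

type_synonym language = "bool list set"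

definition hamming :: "bool list \<Rightarrow> bool list \<Rightarrow> nat" where
  "hamming xs ys = card {j. j < length xs \<and> j < length ys \<and> xs ! j \<noteq> ys ! j}
                   + (max (length xs) (length ys) - min (length xs) (length ys))"

definition logbits :: "nat \<Rightarrow> nat \<Rightarrow> nat" where
  "logbits k n = k * nat \<lceil>log 2 (real (max n 2))\<rceil>"

definition AVG_tau_LCL :: "language set" where
  "AVG_tau_LCL = {L. \<exists>(k::nat) (e::real) M. wf_machine M \<and>
     (\<forall>x \<tau>. length \<tau> = length x ^ k \<longrightarrow>
        halts M x (logbits k (length x)) \<tau> \<and>
        cout (final M x (logbits k (length x)) \<tau>) = [x \<in> L]) \<and>
     (\<forall>x. (\<Sum>\<tau>\<in>{\<tau>. length \<tau> = length x ^ k}.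
             real (hamming \<tau> (caux (final M x (logbits k (length x)) \<tau>))))
           / 2 ^ (length x ^ k) \<le> e)}"

text \<open>BPP: a deterministic machine reading the input and a uniformly random string
  r of length T(n) = (n+2)^c on its auxiliary tape, with a work tape of T(n) cells
  (enough, since it halts within T(n) steps), that halts within T(n) steps on every
  random string and outputs L(x) with probability at least 2/3.\<close>
definition BPP :: "language set" where
  "BPP = {L. \<exists>(c::nat) M. wf_machine M \<and>
     (\<forall>x r. length r = (length x + 2) ^ c \<longrightarrow>
        halts_within M x ((length x + 2) ^ c) r ((length x + 2) ^ c)) \<and>
     (\<forall>x. real (card {r. length r = (length x + 2) ^ c \<and>
             cout (final M x ((length x + 2) ^ c) r) = [x \<in> L]})
           \<ge> 2 / 3 * 2 ^ ((length x + 2) ^ c))}"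

end

theory Submission
  imports Defs
begin

text \<open>
  For a fixed input, all runs passing through one configuration end with the same catalytic tape
  \<open>\<tau>'\<close>. By Markov, most initial tapes \<open>\<tau>\<close> lie within a constant distance \<open>D\<close> of their \<open>\<tau>'\<close>, and at
  most \<open>(n^k + 1)^D\<close> such \<open>\<tau>\<close> share a configuration. A halting run never repeats a configuration
  and there are only \<open>poly(n) * 2^(n^k)\<close> of them, so the average running time over these \<open>\<tau>\<close> is
  polynomial. Hence simulating the machine for polynomially many steps, with the random string in
  the role of \<open>\<tau>\<close>, gives the correct answer with probability at least \<open>2/3\<close>.

  The simulation must enforce the exact tape lengths \<open>n^k\<close> and \<open>k * \<lceil>log\<^sub>2 n\<rceil>\<close> and a step bound on
  tapes carrying no end-markers. It keeps all counters as base-\<open>n\<close> digits, each digit being the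
  position of a mark on an extra track of the input tape, and updates all marks in one sweep.
\<close>

section \<open>Most runs are short\<close>

text \<open>Closeness is what makes the counting work: only tapes near one common final tape can
  pass through a given configuration, whereas otherwise exponentially many runs might merge and
  nothing would bound the average time. The output tape is left out of these configurations, as it
  is never read and would make their number infinite. The permitted error \<open>1/3\<close> is
  split into two sixths: tapes that end too far away (\<open>D \<ge> 6 * e\<close>), and close tapes
  on which \<open>M\<close> runs for \<open>n^a\<close> steps or more.

  The available tapes are longer than those of \<open>M\<close>, and only the input tape has visible
  ends, so every border of a simulated tape must be expressed by positions on the input tape. A
  finite control cannot hold such positions, but a sweep can tell it whether two marks share a cell.
  Comparisons with marks in the cells \<open>0\<close>, \<open>1\<close>, \<open>n\<close> and
  \<open>\<lceil>log\<^sub>2 n\<rceil>\<close> are enough for carries, borders and the clock. When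
  the clock runs out, the simulation stops with whatever it has output, and this event is charged to
  the error.\<close>

lemma run_0 [simp]: "run M x wl aux 0 = init_config wl aux"
  by (simp add: run_def)

lemma run_Suc: "run M x wl aux (Suc t) = step M x (run M x wl aux t)"
  by (simp add: run_def)

lemma run_add: "run M x wl aux (s + t) = (step M x ^^ s) (run M x wl aux t)"
  by (simp add: run_def funpow_add)

lemma step_halting: "halting M (cstate cf) \<Longrightarrow> step M x cf = cf"
  by (cases cf) (simp add: step_def cstate_def)

lemma run_halting_stable:
  assumes "halting M (cstate (run M x wl aux t))" "t \<le> t'"
  shows "run M x wl aux t' = run M x wl aux t"
  using assms(2)
proof (induction t' rule: dec_induct)
  case (step s)
  then show ?case using assms(1) by (simp add: run_Suc step_halting)
qed simp

lemma final_eq_run: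
  assumes "halting M (cstate (run M x wl aux t))"
  shows "final M x wl aux = run M x wl aux t"
  unfolding final_def
  by (metis (mono_tags, lifting) LeastI Least_le assms run_halting_stable)

section \<open>Configurations without the output tape\<close>

definition core :: "config \<Rightarrow> nat \<times> nat \<times> bool list \<times> nat \<times> bool list \<times> nat" where
  "core cf = (case cf of (q, i, w, wh, c, ch, out) \<Rightarrow> (q, i, w, wh, c, ch))"

lemma core_eqD: "core a = core b \<Longrightarrow> cstate a = cstate b \<and> caux a = caux b"
  by (cases a; cases b) (simp add: core_def cstate_def caux_def)

lemma core_step: "core a = core b \<Longrightarrow> core (step M x a) = core (step M x b)"
  by (cases a; cases b) (auto simp: core_def step_def split: prod.splits)

lemma core_funpow_step:
  "core a = core b \<Longrightarrow> core ((step M x ^^ t) a) = core ((step M x ^^ t) b)"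
  by (induction t) (auto intro: core_step)

definition core_space :: "machine \<Rightarrow> nat \<Rightarrow> nat \<Rightarrow> nat \<Rightarrow>
    (nat \<times> nat \<times> bool list \<times> nat \<times> bool list \<times> nat) set" where
  "core_space M n wl m = {..<nstates M} \<times> {..n + 1} \<times> {w. length w = wl} \<times> {..wl} \<times>
     {c. length c = m} \<times> {..m}"

lemma finite_bool_lists: "finite {w :: bool list. length w = n}"
  using finite_lists_length_eq[of "UNIV :: bool set" n] by simp

lemma card_bool_lists: "card {w :: bool list. length w = n} = 2 ^ n"
  using card_lists_length_eq[of "UNIV :: bool set" n] by simp

lemma finite_core_space: "finite (core_space M n wl m)"
  unfolding core_space_def by (intro finite_cartesian_product finite_bool_lists) auto

lemma card_core_space:
  "card (core_space M n wl m) = nstates M * ((n + 2) * (2 ^ wl * ((wl + 1) * (2 ^ m * (m + 1)))))"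
  unfolding core_space_def by (simp add: card_cartesian_product card_bool_lists)

lemma mv_le: "mv p d b \<le> b"
  by (auto simp: mv_def)

lemma core_run_in_core_space:
  assumes "wf_machine M" "length aux = m"
  shows "core (run M x wl aux t) \<in> core_space M (length x) wl m"
proof (induction t)
  case 0
  then show ?case using assms
    by (simp add: core_def core_space_def init_config_def wf_machine_def)
next
  case (Suc t)
  obtain q i w wh c ch out where cf: "run M x wl aux t = (q, i, w, wh, c, ch, out)"
    by (metis prod_cases7)
  obtain q' di ww dw cw dc ob where
    d: "delta M q (insym x i) (rd w wh) (rd c ch) = (q', di, ww, dw, cw, dc, ob)"
    by (metis prod_cases7)
  have q': "q < nstates M \<Longrightarrow> q' < nstates M"
    using assms(1) d unfolding wf_machine_def by (metis fst_conv)
  have le: "mv wh dw (wl - Suc 0) \<le> wl" "mv ch dc (m - Suc 0) \<le> m"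
    "mv i di (Suc (length x)) \<le> Suc (length x)"
    using mv_le le_trans diff_le_self by blast+
  show ?case using Suc cf d q' le
    by (auto simp: run_Suc core_def core_space_def step_def)
qed

lemma length_caux_run:
  assumes "wf_machine M" "length aux = m"
  shows "length (caux (run M x wl aux t)) = m"
  using core_run_in_core_space[OF assms, of x wl t]
  by (auto simp: core_space_def core_def caux_def split: prod.splits)

text \<open>A string within distance \<open>D\<close> of \<open>ys\<close> is given by its at most \<open>D\<close> disagreement positions,
  which are listed with the out-of-range index \<open>m\<close> as padding.\<close>
lemma card_hamming_ball:
  assumes "length ys = m"
  shows "finite {xs. length xs = m \<and> hamming xs ys \<le> D}"
    and "card {xs. length xs = m \<and> hamming xs ys \<le> D} \<le> (m + 1) ^ D"
proof -
  let ?B = "{xs. length xs = m \<and> hamming xs ys \<le> D}"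
  let ?P = "{ps. set ps \<subseteq> {..m} \<and> length ps = D}"
  define f where "f ps = map (\<lambda>j. (ys ! j) \<noteq> (j \<in> set ps)) [0..<m]" for ps :: "nat list"
  show "finite ?B" by (rule finite_subset[OF _ finite_bool_lists[of m]]) auto
  have "?B \<subseteq> f ` ?P"
  proof
    fix xs assume xs: "xs \<in> ?B"
    define S where "S = {j. j < m \<and> xs ! j \<noteq> ys ! j}"
    have S: "finite S" "card S \<le> D" "S \<subseteq> {..<m}"
      using xs assms by (auto simp: S_def hamming_def)
    obtain qs where qs: "set qs = S" "length qs = card S"
      using finite_distinct_list[OF S(1)] distinct_card by metis
    define ps where "ps = qs @ replicate (D - card S) m"
    have "ps \<in> ?P" using S qs by (auto simp: ps_def)
    moreover have "xs = f ps"
      using xs qs by (intro nth_equalityI) (auto simp: f_def ps_def S_def)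
    ultimately show "xs \<in> f ` ?P" by blast
  qed
  then have "card ?B \<le> card ?P"
    using finite_lists_length_eq[of "{..m}" D] by (intro surj_card_le) auto
  also have "\<dots> = (m + 1) ^ D" using card_lists_length_eq[of "{..m}" D] by simp
  finally show "card ?B \<le> (m + 1) ^ D" .
qed

section \<open>Counting slow runs\<close>

lemma card_le_card_times_fibre:
  assumes "finite A" "finite B" "f ` A \<subseteq> B" "\<And>y. y \<in> B \<Longrightarrow> card {x \<in> A. f x = y} \<le> N"
  shows "card A \<le> card B * N"
proof -
  have "A = (\<Union>y\<in>B. {x \<in> A. f x = y})" using assms(3) by auto
  then have "card A \<le> (\<Sum>y\<in>B. card {x \<in> A. f x = y})"
    using card_UN_le[OF assms(2), of "\<lambda>y. {x \<in> A. f x = y}"] by simp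
  also have "\<dots> \<le> card B * N" using sum_bounded_above[of B _ N] assms(4) by simp
  finally show ?thesis .
qed

definition halt_time :: "machine \<Rightarrow> bool list \<Rightarrow> nat \<Rightarrow> bool list \<Rightarrow> nat" where
  "halt_time M x wl aux = (LEAST t. halting M (cstate (run M x wl aux t)))"

lemma halting_at_halt_time:
  "halts M x wl aux \<Longrightarrow> halting M (cstate (run M x wl aux (halt_time M x wl aux)))"
  unfolding halts_def halt_time_def by (rule LeastI_ex)

lemma halting_iff_halt_time:
  assumes "halts M x wl aux"
  shows "halting M (cstate (run M x wl aux t)) \<longleftrightarrow> halt_time M x wl aux \<le> t"
  using halting_at_halt_time[OF assms] run_halting_stable
  by (metis Least_le halt_time_def)

text \<open>A halting run never repeats a core configuration, and all runs through the same core
  configuration end with the same catalytic tape, so their initial tapes lie in one Hamming ball.\<close>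
lemma card_slow_close_runs:
  assumes wf: "wf_machine M" and hlt: "\<And>\<tau>. length \<tau> = m \<Longrightarrow> halts M x wl \<tau>"
  shows "card {\<tau>. length \<tau> = m \<and> hamming \<tau> (caux (final M x wl \<tau>)) \<le> D \<and>
            R \<le> halt_time M x wl \<tau>} * R
         \<le> card (core_space M (length x) wl m) * (m + 1) ^ D"
proof -
  let ?ht = "halt_time M x wl" and ?run = "run M x wl"
  let ?G = "{\<tau>. length \<tau> = m \<and> hamming \<tau> (caux (final M x wl \<tau>)) \<le> D \<and> R \<le> ?ht \<tau>}"
  let ?A = "?G \<times> {..<R}"
  define f where "f = (\<lambda>(\<tau>, t). core (?run \<tau> t))"
  have finG: "finite ?G" by (rule finite_subset[OF _ finite_bool_lists[of m]]) auto
  have adv: "core (?run \<tau> (s + t)) = core (?run \<tau>' (s + t'))"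
    if "core (?run \<tau> t) = core (?run \<tau>' t')" for \<tau> t \<tau>' t' s
    unfolding run_add using core_funpow_step[OF that] .
  have same_final: "caux (final M x wl \<tau>) = caux (final M x wl \<tau>')"
    if "length \<tau> = m" "length \<tau>' = m" "core (?run \<tau> t) = core (?run \<tau>' t')" for \<tau> t \<tau>' t'
  proof -
    \<comment> \<open>After \<open>?s\<close> further steps both runs have halted, whatever
      \<open>t\<close> and \<open>t'\<close> are, and a halted run no longer changes.\<close>
    let ?s = "?ht \<tau> + ?ht \<tau>'"
    have "halting M (cstate (?run \<tau> (?s + t)))" "halting M (cstate (?run \<tau>' (?s + t')))"
      using that(1,2) hlt halting_iff_halt_time by auto
    then show ?thesis using adv[OF that(3), of ?s] final_eq_run core_eqD by metis
  qed
  have no_rep: "\<not> t < t'"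
    if "length \<tau> = m" "t' < ?ht \<tau>" "core (?run \<tau> t) = core (?run \<tau> t')" for \<tau> t t'
  proof
    assume "t < t'"
    \<comment> \<open>\<open>?s\<close> more steps take the later occurrence exactly to the halting
      time, while the earlier one is still \<open>t' - t\<close> steps short of it.\<close>
    let ?s = "?ht \<tau> - t'"
    have "halting M (cstate (?run \<tau> (?s + t')))" "\<not> halting M (cstate (?run \<tau> (?s + t)))"
      using that(1,2) hlt halting_iff_halt_time \<open>t < t'\<close> by auto
    then show False using adv[OF that(3), of ?s] core_eqD by metis
  qed
  have "card {z \<in> ?A. f z = y} \<le> (m + 1) ^ D" for y
  proof (cases "{z \<in> ?A. f z = y} = {}")
    case False
    then obtain \<tau>\<^sub>0 t\<^sub>0 where 0: "length \<tau>\<^sub>0 = m" "core (?run \<tau>\<^sub>0 t\<^sub>0) = y"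
      by (auto simp: f_def)
    let ?B = "{\<tau>. length \<tau> = m \<and> hamming \<tau> (caux (final M x wl \<tau>\<^sub>0)) \<le> D}"
    have len: "length (caux (final M x wl \<tau>\<^sub>0)) = m"
      unfolding final_def by (rule length_caux_run[OF wf 0(1)])
    have "inj_on fst {z \<in> ?A. f z = y}"
    proof (rule inj_onI)
      fix z z' assume z: "z \<in> {z \<in> ?A. f z = y}" "z' \<in> {z \<in> ?A. f z = y}" "fst z = fst z'"
      obtain \<tau> t t' where eq: "z = (\<tau>, t)" "z' = (\<tau>, t')" using z(3) by (cases z; cases z') auto
      have "\<not> t < t'" "\<not> t' < t" using z eq no_rep[of \<tau> t' t] no_rep[of \<tau> t t']
        by (auto simp: f_def)
      then show "z = z'" using eq by simp
    qed
    moreover have "fst ` {z \<in> ?A. f z = y} \<subseteq> ?B"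
    proof
      fix \<tau> assume "\<tau> \<in> fst ` {z \<in> ?A. f z = y}"
      then obtain t where "hamming \<tau> (caux (final M x wl \<tau>)) \<le> D" "length \<tau> = m"
        "core (?run \<tau> t) = y" by (auto simp: f_def)
      then show "\<tau> \<in> ?B" using same_final[of \<tau> \<tau>\<^sub>0 t t\<^sub>0] 0 by simp
    qed
    ultimately have "card {z \<in> ?A. f z = y} \<le> card ?B"
      using card_hamming_ball(1)[OF len] by (intro card_inj_on_le)
    then show ?thesis using card_hamming_ball(2)[OF len, of D] by linarith
  qed (simp only: card.empty)
  moreover have "f ` ?A \<subseteq> core_space M (length x) wl m"
    using core_run_in_core_space[OF wf] by (auto simp: f_def)
  ultimately have "card ?A \<le> card (core_space M (length x) wl m) * (m + 1) ^ D"
    using finG finite_core_space by (intro card_le_card_times_fibre[of _ _ f]) auto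
  then show ?thesis by (simp add: card_cartesian_product)
qed

text \<open>Markov's inequality at the threshold \<open>D\<close> leaves at most a sixth of the
  tapes too far away, and \<open>card_slow_close_runs\<close> leaves at most a sixth that are close
  but slow. A union bound keeps the other two thirds.\<close>

lemma card_fast_runs:
  fixes e :: real
  assumes wf: "wf_machine M" and hlt: "\<And>\<tau>. length \<tau> = m \<Longrightarrow> halts M x wl \<tau>"
    and avg: "(\<Sum>\<tau>\<in>{\<tau>. length \<tau> = m}. real (hamming \<tau> (caux (final M x wl \<tau>)))) / 2 ^ m \<le> e"
    and D: "6 * e \<le> real D"
    and R: "6 * card (core_space M (length x) wl m) * (m + 1) ^ D \<le> R * 2 ^ m" "0 < R"
  shows "2 / 3 * 2 ^ m \<le> real (card {\<tau>. length \<tau> = m \<and> halt_time M x wl \<tau> < R})"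
proof -
  let ?U = "{\<tau> :: bool list. length \<tau> = m}"
  let ?h = "\<lambda>\<tau>. hamming \<tau> (caux (final M x wl \<tau>))"
  let ?far = "{\<tau>. length \<tau> = m \<and> D < ?h \<tau>}"
  let ?slow = "{\<tau>. length \<tau> = m \<and> ?h \<tau> \<le> D \<and> R \<le> halt_time M x wl \<tau>}"
  let ?fast = "{\<tau>. length \<tau> = m \<and> halt_time M x wl \<tau> < R}"
  have fin: "finite ?far" "finite ?slow" "finite ?fast" "finite ?U"
    by (rule finite_subset[OF _ finite_bool_lists[of m]]; auto)+
  \<comment> \<open>A distance beyond \<open>D\<close> is at least \<open>D + 1\<close>, a factor
    that can be cancelled even if \<open>D = 0\<close>.\<close>
  have "real (card ?far) * (real D + 1) = (\<Sum>\<tau>\<in>?far. real D + 1)" by simp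
  also have "\<dots> \<le> (\<Sum>\<tau>\<in>?far. real (?h \<tau>))" by (intro sum_mono) auto
  also have "\<dots> \<le> (\<Sum>\<tau>\<in>?U. real (?h \<tau>))" using fin by (intro sum_mono2) auto
  also have "\<dots> \<le> e * 2 ^ m" using avg by (simp add: field_simps)
  also have "\<dots> \<le> (real D + 1) / 6 * 2 ^ m" using D by (intro mult_right_mono) auto
  finally have "(6 * real (card ?far)) * (real D + 1) \<le> 2 ^ m * (real D + 1)" by simp
  then have far: "6 * real (card ?far) \<le> 2 ^ m" by (rule mult_right_le_imp_le) simp
  have "6 * (card ?slow * R) \<le> 6 * (card (core_space M (length x) wl m) * (m + 1) ^ D)"
    using card_slow_close_runs[OF wf hlt, of m D R] by (intro mult_left_mono) auto
  also have "\<dots> \<le> R * 2 ^ m" using R(1) by (simp only: mult.assoc)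
  finally have "6 * card ?slow * R \<le> 2 ^ m * R" by (simp only: mult.assoc mult.commute[of R])
  then have "6 * card ?slow \<le> 2 ^ m" using R(2) by (rule mult_right_le_imp_le)
  then have "real (6 * card ?slow) \<le> real (2 ^ m)" by (rule of_nat_mono)
  then have slow: "6 * real (card ?slow) \<le> 2 ^ m" by simp
  have "card ?U \<le> card (?far \<union> ?slow \<union> ?fast)" using fin by (intro card_mono) auto
  then have "card ?U \<le> card ?far + card ?slow + card ?fast"
    using card_Un_le[of "?far \<union> ?slow" ?fast] card_Un_le[of ?far ?slow] by linarith
  then have "2 ^ m \<le> card ?far + card ?slow + card ?fast" unfolding card_bool_lists .
  then have "real (2 ^ m) \<le> real (card ?far + card ?slow + card ?fast)" by (rule of_nat_mono)
  then have "2 ^ m \<le> real (card ?far) + real (card ?slow) + real (card ?fast)" by simp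
  with far slow show ?thesis by linarith
qed

section \<open>Sweep automata\<close>

type_synonym 's tconfig = "'s \<times> nat \<times> bool list \<times> nat \<times> bool list \<times> nat \<times> bool list"

type_synonym 's trans =
  "'s \<Rightarrow> bool option \<Rightarrow> bool \<Rightarrow> bool \<Rightarrow> 's \<times> int \<times> bool \<times> int \<times> bool \<times> int \<times> bool option"

definition emit :: "bool list \<Rightarrow> bool option \<Rightarrow> bool list" where
  "emit out ob = (case ob of None \<Rightarrow> out | Some b \<Rightarrow> out @ [b])"

lemma emit_simps [simp]: "emit out None = out" "emit out (Some b) = out @ [b]"
  by (simp_all add: emit_def)

definition tstep :: "'s trans \<Rightarrow> ('s \<Rightarrow> bool) \<Rightarrow> bool list \<Rightarrow> 's tconfig \<Rightarrow> 's tconfig" where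
  "tstep \<delta> hl x cf = (case cf of (q, i, w, wh, c, ch, out) \<Rightarrow>
     if hl q then cf else
     (case \<delta> q (insym x i) (rd w wh) (rd c ch) of (q', di, ww, dw, cw, dc, ob) \<Rightarrow>
        (q', mv i di (length x + 1), w[wh := ww], mv wh dw (length w - 1),
         c[ch := cw], mv ch dc (length c - 1), emit out ob)))"

text \<open>The states are numbered by an injection into the naturals, shifted by \<open>Suc\<close>
  so that \<open>s0\<close> receives the prescribed start number \<open>0\<close>.\<close>

lemma machine_of_trans:
  fixes S :: "'s set" and \<delta> :: "'s trans"
  assumes fin: "finite S" and s0: "s0 \<in> S"
    and closed: "\<And>s a w c. s \<in> S \<Longrightarrow> fst (\<delta> s a w c) \<in> S"
  shows "\<exists>M. wf_machine M \<and> (\<forall>x wl aux t.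
    let cf = (tstep \<delta> hl x ^^ t) (s0, 0, replicate wl False, 0, aux, 0, []) in
      halting M (cstate (run M x wl aux t)) = hl (fst cf) \<and>
      cout (run M x wl aux t) = snd (snd (snd (snd (snd (snd cf))))))"
proof -
  obtain f :: "'s \<Rightarrow> nat" where f: "inj_on f S"
    using finite_imp_inj_to_nat_seg[OF fin] by auto
  define enc where "enc s = (if s = s0 then 0 else Suc (f s))" for s
  have inj: "inj_on enc S" using f by (auto simp: enc_def inj_on_def)
  define dec where "dec = inv_into S enc"
  have dec: "dec (enc s) = s" if "s \<in> S" for s
    using that inj by (simp add: dec_def)
  \<comment> \<open>\<open>wf_machine\<close> concerns every number below \<open>nstates\<close>,
    also those that encode no state; these are sent to \<open>0\<close>, the code of
    \<open>s0\<close>.\<close>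
  define M where "M = \<lparr>nstates = Suc (Max (enc ` S)),
    delta = (\<lambda>q a w c. if q \<in> enc ` S then apfst enc (\<delta> (dec q) a w c)
                       else (0, 0, False, 0, False, 0, None)),
    halting = (\<lambda>q. hl (dec q))\<rparr>"
  have wf: "wf_machine M"
    using fin closed dec by (auto simp: wf_machine_def M_def less_Suc_eq_le)
  have sim: "fst cf \<in> S \<Longrightarrow> step M x (apfst enc cf) = apfst enc (tstep \<delta> hl x cf) \<and>
     fst (tstep \<delta> hl x cf) \<in> S" for x and cf :: "'s tconfig"
    using closed[of "fst cf"]
    by (cases cf) (auto simp: step_def tstep_def M_def dec emit_def split: prod.splits; metis fst_conv)
  have runs: "run M x wl aux t =
      apfst enc ((tstep \<delta> hl x ^^ t) (s0, 0, replicate wl False, 0, aux, 0, [])) \<and>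
      fst ((tstep \<delta> hl x ^^ t) (s0, 0, replicate wl False, 0, aux, 0, [])) \<in> S" for x wl aux t
  proof (induction t)
    case 0
    show ?case by (simp add: init_config_def s0 enc_def)
  qed (auto simp: run_Suc sim)
  show ?thesis
  proof (intro exI[of _ M] conjI wf allI)
    fix x wl aux t
    show "let cf = (tstep \<delta> hl x ^^ t) (s0, 0, replicate wl False, 0, aux, 0, []) in
      halting M (cstate (run M x wl aux t)) = hl (fst cf) \<and>
      cout (run M x wl aux t) = snd (snd (snd (snd (snd (snd cf)))))"
      using runs[of x wl aux t]
      by (auto simp: Let_def M_def cstate_def cout_def dec apfst_def map_prod_def split: prod.splits)
  qed
qed

lemma mv_0: "p \<le> b \<Longrightarrow> mv p 0 b = p"
  by (simp add: mv_def)

lemma mv_in_range: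
  "int p + sgn d = int p' \<Longrightarrow> p' \<le> b \<Longrightarrow> mv p d b = p'"
  by (auto simp: mv_def)

lemma list_update_rd: "c[h := rd c h] = c"
  by (cases "h < length c") (auto simp: rd_def list_update_beyond)

lemma funpow_comp: "(f ^^ (m + n)) a = (f ^^ n) ((f ^^ m) a)"
  by (metis add.commute comp_apply funpow_add)

lemma funpow_chain:
  assumes "(f ^^ m) a = b" "(f ^^ n) b = c"
  shows "(f ^^ (m + n)) a = c"
  using assms by (simp add: funpow_comp)

section \<open>Cell layout and control of a sweep\<close>

text \<open>On inputs of any length a finite control can only collect a bounded summary. Which pairs
  occur, without position or multiplicity, is such a summary.\<close>

type_synonym obs = "(bool option \<times> nat set) set"

text \<open>\<open>Scan\<close> carries the content of the cell just left and the pairs seen so far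
  on the way right. \<open>Back\<close> carries the complete set of pairs and the old content of the
  cell to the right.\<close>

datatype 'q phase = Scan 'q "nat set" obs | Back 'q obs "nat set"

text \<open>One visit of a cell: \<open>Read\<close> collects its block of bits,
  \<open>Write\<close> puts the new block back starting from its right end, and \<open>Move\<close>
  counts the steps to the next block.\<close>

datatype 'q sstate = Read "bool list" "'q phase" | Write "bool list" "'q phase" int
  | Move nat "'q phase" int

type_synonym 'q sconfig = "'q \<times> (nat \<Rightarrow> nat set) \<times> bool list \<times> nat \<times> bool list"

text \<open>Both ends of the input show the symbol \<open>None\<close>. The artificial content
  \<open>{0}\<close> to the left of cell \<open>0\<close> tells the left end from the right
  one.\<close>

definition left_nb :: "(nat \<Rightarrow> nat set) \<Rightarrow> nat \<Rightarrow> nat set" where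
  "left_nb c p = (if p = 0 then {0} else c (p - 1))"

definition view :: "bool list \<Rightarrow> (nat \<Rightarrow> nat set) \<Rightarrow> obs" where
  "view x c = (\<lambda>p. (insym x p, c p)) ` {..length x + 1}"

text \<open>A sweep automaton keeps a subset of \<open>{1..<W}\<close> in each of the cells \<open>0..n+1\<close> of the input
  tape. In one round it sees the set of all pairs (input symbol, cell content), and every cell is
  rewritten from its own content and that of its two neighbours; the index \<open>0\<close> is reserved
  for the virtual left neighbour of cell \<open>0\<close>. The machine implementing it spends \<open>2 * W\<close> work tape
  bits per cell: \<open>W\<close> for the content and \<open>W\<close> for a copy of the content of the left neighbour,
  which the scan to the right leaves behind for the scan back.\<close>
locale sweep_automaton =
  fixes W :: nat
    and F :: "'q \<Rightarrow> obs \<Rightarrow> bool \<Rightarrow> nat set \<Rightarrow> nat set \<Rightarrow> nat set \<Rightarrow> nat set"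
    and G :: "'q \<Rightarrow> obs \<Rightarrow> bool \<Rightarrow> 'q \<times> bool \<times> int \<times> bool option"
    and hlt :: "'q \<Rightarrow> bool" and Q :: "'q set" and q0 :: 'q
  assumes W: "0 < W" and finQ: "finite Q" and q0: "q0 \<in> Q"
    and G_closed: "\<And>q ob b. q \<in> Q \<Longrightarrow> fst (G q ob b) \<in> Q"
    and F_range: "\<And>q ob b l m r. F q ob b l m r \<subseteq> {1..<W}"
begin

definition sweep_round :: "bool list \<Rightarrow> 'q sconfig \<Rightarrow> 'q sconfig" where
  "sweep_round x cf = (case cf of (q, c, aux, ah, out) \<Rightarrow>
     if hlt q then cf else
     (case G q (view x c) (rd aux ah) of (q', aw, am, ob) \<Rightarrow>
       (q', \<lambda>p. if p \<le> length x + 1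
                then F q (view x c) (rd aux ah) (left_nb c p) (c p) (c (p + 1)) else {},
        aux[ah := aw], mv ah am (length aux - 1), emit out ob)))"

text \<open>The intersection with \<open>{..<W}\<close> discards the copy of the neighbour. The
  action of \<open>G\<close> on the auxiliary tape is postponed until the sweep is back in cell
  \<open>0\<close>, so that the bit \<open>b\<close> is the same in every cell of the round.\<close>

definition cell_step :: "'q phase \<Rightarrow> bool option \<Rightarrow> nat set \<Rightarrow> bool \<Rightarrow>
    'q phase \<times> nat set \<times> int \<times> bool \<times> int \<times> bool option" where
  "cell_step ph a c b = (case ph of
     Scan q prev ob \<Rightarrow>
       let m = c \<inter> {..<W}; c' = m \<union> (+) W ` prev; ob' = insert (a, m) ob in
       if a = None \<and> 0 \<notin> prev then (Back q ob' {}, c', 0, b, 0, None)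
       else (Scan q m ob', c', 1, b, 0, None)
   | Back q ob nxt \<Rightarrow>
       let m = c \<inter> {..<W}; l = {i. i < W \<and> W + i \<in> c}; c' = F q ob b l m nxt in
       if 0 \<in> l then (case G q ob b of (q', act) \<Rightarrow> (Scan q' {0} {}, c', 0, act))
       else (Back q ob m, c', -1, b, 0, None))"

definition sdelta :: "'q sstate trans" where
  "sdelta s a w b = (case s of
     Read l ph \<Rightarrow> let l' = l @ [w] in
       if length l' < 2 * W then (Read l' ph, 0, w, 1, b, 0, None)
       else (case cell_step ph a {i. i < 2 * W \<and> l' ! i} b of (ph', c', d, aw, am, ob) \<Rightarrow>
         (Write (map (\<lambda>i. i \<in> c') [0..<2 * W]) ph' d, 0, w, 0, aw, am, ob))
   | Write l ph d \<Rightarrow>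
       if length l \<le> 1 then (Move (2 * W) ph d, d, last l, 0, b, 0, None)
       else (Write (butlast l) ph d, 0, last l, -1, b, 0, None)
   | Move k ph d \<Rightarrow> (if k \<le> 1 then Read [] ph else Move (k - 1) ph d, 0, w, d, b, 0, None))"

definition shlt :: "'q sstate \<Rightarrow> bool" where
  "shlt s = (case s of Read l (Scan q prev ob) \<Rightarrow> hlt q | _ \<Rightarrow> False)"

abbreviation "sstep \<equiv> tstep sdelta shlt"

definition phases :: "'q phase set" where
  "phases = (\<lambda>(q, p, ob). Scan q p ob) ` (Q \<times> Pow {..<W} \<times> Pow (UNIV \<times> Pow {..<W}))
          \<union> (\<lambda>(q, p, ob). Back q ob p) ` (Q \<times> Pow {..<W} \<times> Pow (UNIV \<times> Pow {..<W}))"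

definition sstates :: "'q sstate set" where
  "sstates = (\<lambda>(l, ph). Read l ph) ` ({l. set l \<subseteq> UNIV \<and> length l \<le> 2 * W} \<times> phases)
    \<union> (\<lambda>(l, ph, d). Write l ph d) ` ({l. set l \<subseteq> UNIV \<and> length l \<le> 2 * W} \<times> phases \<times> {-1, 0, 1})
    \<union> (\<lambda>(k, ph, d). Move k ph d) ` ({..2 * W} \<times> phases \<times> {-1, 0, 1})"

lemma phases_simps [simp]:
  "Scan q p ob \<in> phases \<longleftrightarrow> q \<in> Q \<and> p \<subseteq> {..<W} \<and> ob \<subseteq> UNIV \<times> Pow {..<W}"
  "Back q ob p \<in> phases \<longleftrightarrow> q \<in> Q \<and> p \<subseteq> {..<W} \<and> ob \<subseteq> UNIV \<times> Pow {..<W}"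
  unfolding phases_def by (auto simp: image_iff)

lemma sstates_simps [simp]:
  "Read l ph \<in> sstates \<longleftrightarrow> length l \<le> 2 * W \<and> ph \<in> phases"
  "Write l ph d \<in> sstates \<longleftrightarrow> length l \<le> 2 * W \<and> ph \<in> phases \<and> d \<in> {-1, 0, 1}"
  "Move k ph d \<in> sstates \<longleftrightarrow> k \<le> 2 * W \<and> ph \<in> phases \<and> d \<in> {-1, 0, 1}"
  unfolding sstates_def by (auto simp: image_iff)

lemma finite_sstates: "finite sstates"
proof -
  have "finite phases" unfolding phases_def
    by (intro finite_UnI finite_imageI finite_cartesian_product finQ) auto
  then show ?thesis unfolding sstates_def
    by (intro finite_UnI finite_imageI finite_cartesian_product finite_lists_length_le) auto
qed

lemma cell_step_closed:
  assumes "ph \<in> phases" "cell_step ph a c b = (ph', c', d, act)"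
  shows "ph' \<in> phases \<and> d \<in> {-1, 0, 1}"
proof (cases ph)
  case (Scan q prev ob)
  then show ?thesis using assms
    by (auto simp: cell_step_def Let_def split: if_splits)
next
  case (Back q ob nxt)
  then have "fst (G q ob b) \<in> Q" using assms G_closed by simp
  then show ?thesis using assms Back W
    by (auto simp: cell_step_def Let_def split: if_splits prod.splits)
qed

lemma sdelta_closed:
  assumes "s \<in> sstates" shows "fst (sdelta s a w b) \<in> sstates"
proof (cases s)
  case (Read l ph)
  obtain ph' c' d aw am ob where cs:
    "cell_step ph a {i. i < 2 * W \<and> (l @ [w]) ! i} b = (ph', c', d, aw, am, ob)"
    by (metis prod_cases6)
  have "ph' \<in> phases \<and> d \<in> {-1, 0, 1}" using cell_step_closed[OF _ cs] assms Read by simp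
  then show ?thesis using assms Read cs by (simp add: sdelta_def Let_def)
qed (use assms in \<open>auto simp: sdelta_def\<close>)

section \<open>The visit of one cell\<close>

text \<open>Stops one bit short of a full block: reading the last bit is the transition that applies
  \<open>cell_step\<close>.\<close>

lemma Read_steps:
  assumes "\<not> shlt (Read [] ph)" "s + j < length w" "j < 2 * W" "i \<le> length x + 1"
    "ah \<le> length aux - 1"
  shows "(sstep x ^^ j) (Read [] ph, i, w, s, aux, ah, out)
       = (Read (map (\<lambda>i. w ! (s + i)) [0..<j]) ph, i, w, s + j, aux, ah, out)"
  using assms(2,3)
proof (induction j)
  case (Suc j)
  have "\<not> shlt (Read l ph)" for l using assms(1) by (simp add: shlt_def)
  moreover have "mv (s + j) 1 (length w - Suc 0) = Suc (s + j)"
    using Suc.prems by (intro mv_in_range) auto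
  moreover have "rd w (s + j) = w ! (s + j)" using Suc.prems by (simp add: rd_def)
  moreover have "w[s + j := w ! (s + j)] = w" by simp
  ultimately show ?case using Suc assms
    by (simp add: tstep_def sdelta_def list_update_rd mv_0)
qed simp

text \<open>\<open>Write\<close> pops its list from the end while the head goes left, hence the
  reverse induction. The leftmost bit is written without a work move, so the head ends at the block
  start \<open>s\<close>; the input head moves in that same step.\<close>

lemma Write_steps:
  assumes "l \<noteq> []" "s + length l \<le> length w" "i \<le> length x + 1" "ah \<le> length aux - 1"
  shows "(sstep x ^^ length l) (Write l ph d, i, w, s + length l - 1, aux, ah, out)
       = (Move (2 * W) ph d, mv i d (length x + 1), take s w @ l @ drop (s + length l) w, s,
          aux, ah, out)"
  using assms(1,2)
proof (induction l arbitrary: w rule: rev_induct)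
  case (snoc b l)
  have nh: "\<not> shlt (Write l ph d)" for l :: "bool list" by (simp add: shlt_def)
  have upd: "w[s + length l := b] = take (s + length l) w @ b # drop (Suc (s + length l)) w"
    using snoc.prems by (intro upd_conv_take_nth_drop) simp
  show ?case
  proof (cases "l = []")
    case True
    then show ?thesis using snoc.prems nh assms upd
      by (simp add: tstep_def sdelta_def list_update_rd mv_0)
  next
    case False
    let ?w = "w[s + length l := b]"
    have "mv (s + length l) (-1) (length w - Suc 0) = s + length l - 1"
      using snoc.prems False by (intro mv_in_range) (auto simp: of_nat_diff Suc_le_eq)
    then have one: "sstep x (Write (l @ [b]) ph d, i, w, s + length l, aux, ah, out)
      = (Write l ph d, i, ?w, s + length l - 1, aux, ah, out)"
      using False nh assms by (simp add: tstep_def sdelta_def list_update_rd mv_0)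
    have "take s ?w @ l @ drop (s + length l) ?w = take s w @ (l @ [b]) @ drop (Suc (s + length l)) w"
      using snoc.prems by (simp add: upd)
    moreover have "(sstep x ^^ length l) (Write l ph d, i, ?w, s + length l - 1, aux, ah, out)
       = (Move (2 * W) ph d, mv i d (length x + 1), take s ?w @ l @ drop (s + length l) ?w, s,
          aux, ah, out)"
      using snoc.prems by (intro snoc.IH False) simp
    ultimately show ?thesis using one by (simp add: funpow_Suc_right del: funpow.simps)
  qed
qed simp

lemma Move_steps:
  assumes "k > 0" "d \<in> {-1, 0, 1}" "int h + int k * d = int h'" "h < length w" "h' < length w"
    "i \<le> length x + 1" "ah \<le> length aux - 1"
  shows "(sstep x ^^ k) (Move k ph d, i, w, h, aux, ah, out) = (Read [] ph, i, w, h', aux, ah, out)"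
  using assms(1,3,4)
proof (induction k arbitrary: h)
  case (Suc k)
  have nh: "\<not> shlt (Move m ph d)" for m by (simp add: shlt_def)
  define g where "g = nat (int h + d)"
  have "0 \<le> int h + d \<and> int h + d < int (length w)"
    using Suc.prems assms(2,5) by auto
  then have g: "int h + d = int g" "g < length w" by (auto simp: g_def)
  have "mv h d (length w - Suc 0) = g" using g assms(2) by (intro mv_in_range) auto
  then have one: "sstep x (Move (Suc k) ph d, i, w, h, aux, ah, out)
     = (if k = 0 then Read [] ph else Move k ph d, i, w, g, aux, ah, out)"
    using nh assms(6,7) by (simp add: tstep_def sdelta_def list_update_rd mv_0)
  have g': "int g + int k * d = int h'" using Suc.prems g by (simp add: algebra_simps)
  show ?case
  proof (cases "k = 0")
    case True
    then show ?thesis using one g' by simp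
  next
    case False
    then show ?thesis using one Suc.IH[of g] g g' by (simp add: funpow_Suc_right del: funpow.simps)
  qed
qed simp

definition stores :: "nat \<Rightarrow> bool list \<Rightarrow> (nat \<Rightarrow> nat set) \<Rightarrow> bool" where
  "stores n w c \<longleftrightarrow> (n + 2) * (2 * W) \<le> length w \<and>
     (\<forall>p\<le>n + 1. \<forall>i<2 * W. w ! (p * (2 * W) + i) \<longleftrightarrow> i \<in> c p)"

lemma cell_step_cong: "c \<inter> {..<2 * W} = c' \<inter> {..<2 * W} \<Longrightarrow> cell_step ph a c b = cell_step ph a c' b"
proof -
  assume eq: "c \<inter> {..<2 * W} = c' \<inter> {..<2 * W}"
  then have "i < 2 * W \<Longrightarrow> i \<in> c \<longleftrightarrow> i \<in> c'" for i by auto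
  then have "c \<inter> {..<W} = c' \<inter> {..<W}" "{i. i < W \<and> W + i \<in> c} = {i. i < W \<and> W + i \<in> c'}"
    by auto
  then show ?thesis by (simp add: cell_step_def split: phase.splits)
qed

lemma stores_update:
  assumes "stores n w c" "p \<le> n + 1"
  shows "stores n (take (p * (2 * W)) w @ map (\<lambda>i. i \<in> c') [0..<2 * W] @
           drop (p * (2 * W) + 2 * W) w) (c(p := c'))"
proof -
  let ?B = "2 * W"
  have len: "(n + 2) * ?B \<le> length w" using assms(1) by (simp add: stores_def)
  have "p * ?B + ?B = (p + 1) * ?B" by simp
  also have "\<dots> \<le> (n + 2) * ?B" using assms(2) by (intro mult_right_mono) auto
  finally have pB: "p * ?B + ?B \<le> length w" using len by simp
  have ne: "r * ?B + i < p * ?B" if "r < p" "i < ?B" for r i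
  proof -
    have "r * ?B + i < (r + 1) * ?B" using that by simp
    also have "\<dots> \<le> p * ?B" using that by (intro mult_right_mono) auto
    finally show ?thesis .
  qed
  have gt: "p * ?B + ?B \<le> r * ?B + i" if "p < r" for r i
  proof -
    have "p * ?B + ?B = (p + 1) * ?B" by simp
    also have "\<dots> \<le> r * ?B" using that by (intro mult_right_mono) auto
    finally show ?thesis by simp
  qed
  have "(take (p * ?B) w @ map (\<lambda>i. i \<in> c') [0..<?B] @ drop (p * ?B + ?B) w) ! (r * ?B + i)
      \<longleftrightarrow> i \<in> (c(p := c')) r" if r: "r \<le> n + 1" "i < ?B" for r i
  proof -
    have old: "w ! (r * ?B + i) \<longleftrightarrow> i \<in> c r" using assms(1) r by (simp add: stores_def)
    consider "r < p" | "r = p" | "p < r" by linarith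
    then show ?thesis
    proof cases
      case 1
      then show ?thesis using ne[OF 1 r(2)] pB old by (simp add: nth_append)
    next
      case 2
      then show ?thesis using pB r by (simp add: nth_append)
    next
      case 3
      then have "p * ?B + ?B + (r * ?B + i - (p * ?B + ?B)) = r * ?B + i" using gt[OF 3] by simp
      moreover have "drop (p * ?B + ?B) w ! (r * ?B + i - (p * ?B + ?B)) = w ! (r * ?B + i)"
        using calculation pB by (subst nth_drop) auto
      moreover have "min (length w) (p * ?B) = p * ?B" using pB by simp
      ultimately show ?thesis using gt[OF 3, of i] pB old 3
        by (auto simp: nth_append not_less diff_diff_left)
    qed
  qed
  then show ?thesis using pB len by (auto simp: stores_def)
qed

text \<open>Reading, writing and moving take \<open>2 * W\<close> steps each. \<open>Move\<close>
  counts down even when \<open>d = 0\<close>, so the duration does not depend on what is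
  stored.\<close>

lemma cell_step_run:
  assumes nh: "\<not> shlt (Read [] ph)" and st: "stores (length x) w c"
    and p: "p \<le> length x + 1" "int p + d = int p'" "p' \<le> length x + 1" and d: "d \<in> {-1, 0, 1}"
    and ah: "ah \<le> length aux - 1"
    and cs: "cell_step ph (insym x p) (c p) (rd aux ah) = (ph', c', d, aw, am, ob)"
  shows "\<exists>w'. (sstep x ^^ (6 * W)) (Read [] ph, p, w, p * (2 * W), aux, ah, out)
     = (Read [] ph', p', w', p' * (2 * W), aux[ah := aw], mv ah am (length aux - 1), emit out ob)
     \<and> stores (length x) w' (c(p := c'))"
proof -
  let ?B = "2 * W" and ?n = "length x"
  let ?w = "take (p * ?B) w @ map (\<lambda>i. i \<in> c') [0..<?B] @ drop (p * ?B + ?B) w"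
  let ?aux = "aux[ah := aw]" and ?ah = "mv ah am (length aux - 1)"
  have len: "(?n + 2) * ?B \<le> length w" using st by (simp add: stores_def)
  have blk: "r * ?B + ?B \<le> length w" if "r \<le> ?n + 1" for r
  proof -
    have "r * ?B + ?B = (r + 1) * ?B" by simp
    also have "\<dots> \<le> (?n + 2) * ?B" using that by (intro mult_right_mono) auto
    finally show ?thesis using len by simp
  qed
  have B: "0 < ?B" using W by simp
  have ah': "?ah \<le> length ?aux - 1" using mv_le by simp
  have R: "(sstep x ^^ (?B - 1)) (Read [] ph, p, w, p * ?B, aux, ah, out)
     = (Read (map (\<lambda>i. w ! (p * ?B + i)) [0..<?B - 1]) ph, p, w, p * ?B + (?B - 1), aux, ah, out)"
    using blk[OF p(1)] B p(1) ah nh by (intro Read_steps) auto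
  define l where "l = map (\<lambda>i. w ! (p * ?B + i)) [0..<?B]"
  have l: "map (\<lambda>i. w ! (p * ?B + i)) [0..<?B - 1] @ [rd w (p * ?B + (?B - 1))] = l"
  proof -
    have "[0..<?B] = [0..<?B - 1] @ [?B - 1]"
      using B by (metis Suc_diff_1 le0 upt_Suc_append)
    moreover have "rd w (p * ?B + (?B - 1)) = w ! (p * ?B + (?B - 1))"
      using blk[OF p(1)] B unfolding rd_def by linarith
    ultimately show ?thesis by (simp add: l_def)
  qed
  have cell: "cell_step ph (insym x p) {i. i < ?B \<and> l ! i} (rd aux ah) = (ph', c', d, aw, am, ob)"
    unfolding cs[symmetric] using st p(1)
    by (intro cell_step_cong) (auto simp: l_def stores_def)
  have "\<not> shlt (Read l' ph)" for l' using nh by (simp add: shlt_def)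
  moreover have "sdelta (Read (map (\<lambda>i. w ! (p * ?B + i)) [0..<?B - 1]) ph) (insym x p)
       (rd w (p * ?B + (?B - 1))) (rd aux ah)
     = (Write (map (\<lambda>i. i \<in> c') [0..<?B]) ph' d, 0, rd w (p * ?B + (?B - 1)), 0, aw, am, ob)"
    unfolding sdelta_def Let_def using l cell B by (simp add: l_def)
  moreover have "mv (p * ?B + (?B - 1)) 0 (length w - 1) = p * ?B + (?B - 1)"
    using blk[OF p(1)] B by (intro mv_0) auto
  ultimately have one: "(sstep x ^^ 1)
      (Read (map (\<lambda>i. w ! (p * ?B + i)) [0..<?B - 1]) ph, p, w, p * ?B + (?B - 1), aux, ah, out)
     = (Write (map (\<lambda>i. i \<in> c') [0..<?B]) ph' d, p, w, p * ?B + (?B - 1), ?aux, ?ah, emit out ob)"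
    using p(1) by (simp add: tstep_def list_update_rd mv_0)
  have mvp: "mv p d (?n + 1) = p'" using p d by (intro mv_in_range) auto
  have "(sstep x ^^ length (map (\<lambda>i. i \<in> c') [0..<?B]))
      (Write (map (\<lambda>i. i \<in> c') [0..<?B]) ph' d, p, w,
        p * ?B + length (map (\<lambda>i. i \<in> c') [0..<?B]) - 1, ?aux, ?ah, emit out ob)
     = (Move ?B ph' d, mv p d (?n + 1),
        take (p * ?B) w @ map (\<lambda>i. i \<in> c') [0..<?B] @
          drop (p * ?B + length (map (\<lambda>i. i \<in> c') [0..<?B])) w, p * ?B, ?aux, ?ah, emit out ob)"
    using B blk[OF p(1)] p(1) ah' by (intro Write_steps) auto
  then have Wr: "(sstep x ^^ ?B)
      (Write (map (\<lambda>i. i \<in> c') [0..<?B]) ph' d, p, w, p * ?B + (?B - 1), ?aux, ?ah, emit out ob)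
     = (Move ?B ph' d, p', ?w, p * ?B, ?aux, ?ah, emit out ob)"
    using B mvp by (simp add: Suc_le_eq)
  have lenw: "length ?w = length w" using blk[OF p(1)] by simp
  have "int (p * ?B) + int ?B * d = (int p + d) * int ?B" by (simp add: algebra_simps)
  also have "\<dots> = int (p' * ?B)" using p by simp
  finally have Mv: "(sstep x ^^ ?B) (Move ?B ph' d, p', ?w, p * ?B, ?aux, ?ah, emit out ob)
     = (Read [] ph', p', ?w, p' * ?B, ?aux, ?ah, emit out ob)"
    using B d blk[OF p(1)] blk[OF p(3)] p(3) ah' lenw by (intro Move_steps) auto
  have "6 * W = ?B - 1 + 1 + ?B + ?B" using B by simp
  then have "(sstep x ^^ (6 * W)) (Read [] ph, p, w, p * ?B, aux, ah, out)
    = (Read [] ph', p', ?w, p' * ?B, ?aux, ?ah, emit out ob)"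
    using funpow_chain[OF funpow_chain[OF funpow_chain[OF R one] Wr] Mv] by simp
  then show ?thesis using stores_update[OF st p(1)] by blast
qed

section \<open>The two passes of a round\<close>

lemma insym_None_iff: "p \<le> length x + 1 \<Longrightarrow> insym x p = None \<longleftrightarrow> p = 0 \<or> p = length x + 1"
  by (auto simp: insym_def)

text \<open>The turning condition cannot hold before the last cell: cell \<open>0\<close> has
  \<open>{0}\<close> as its left neighbour, and the cells in between carry input symbols. Only the
  lower halves of the initial blocks need to be known, as the upper ones are overwritten.\<close>

lemma Scan_sweep:
  assumes c: "\<And>p. c p \<subseteq> {1..<W}" and nh: "\<not> hlt q" and ah: "ah \<le> length aux - 1"
    and st: "stores (length x) w T" "\<And>p. p \<le> length x + 1 \<Longrightarrow> T p \<inter> {..<W} = c p"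
    and j: "j \<le> length x + 1"
  shows "\<exists>w' T'. (sstep x ^^ (j * (6 * W))) (Read [] (Scan q {0} {}), 0, w, 0, aux, ah, out)
     = (Read [] (Scan q (left_nb c j) ((\<lambda>p. (insym x p, c p)) ` {..<j})), j, w', j * (2 * W),
        aux, ah, out)
     \<and> stores (length x) w' T' \<and> (\<forall>p\<le>length x + 1. T' p \<inter> {..<W} = c p)
     \<and> (\<forall>p<j. T' p = c p \<union> (+) W ` left_nb c p)"
  using j
proof (induction j)
  case 0
  show ?case using st by (auto simp: left_nb_def)
next
  case (Suc j)
  let ?O = "(\<lambda>p. (insym x p, c p)) ` {..<j}"
  obtain w' T' where IH:
    "(sstep x ^^ (j * (6 * W))) (Read [] (Scan q {0} {}), 0, w, 0, aux, ah, out)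
     = (Read [] (Scan q (left_nb c j) ?O), j, w', j * (2 * W), aux, ah, out)"
    "stores (length x) w' T'" "\<forall>p\<le>length x + 1. T' p \<inter> {..<W} = c p"
    "\<forall>p<j. T' p = c p \<union> (+) W ` left_nb c p"
    using Suc by auto
  let ?c' = "c j \<union> (+) W ` left_nb c j"
  have "\<not> (insym x j = None \<and> 0 \<notin> left_nb c j)"
    using insym_None_iff[of j x] Suc.prems by (auto simp: left_nb_def)
  moreover have "T' j \<inter> {..<W} = c j" using IH(3) Suc.prems by simp
  ultimately have cs: "cell_step (Scan q (left_nb c j) ?O) (insym x j) (T' j) (rd aux ah)
      = (Scan q (c j) (insert (insym x j, c j) ?O), ?c', 1, rd aux ah, 0, None)"
    by (simp add: cell_step_def Let_def)
  have "\<exists>w''. (sstep x ^^ (6 * W)) (Read [] (Scan q (left_nb c j) ?O), j, w', j * (2 * W), aux, ah, out)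
     = (Read [] (Scan q (c j) (insert (insym x j, c j) ?O)), Suc j, w'', Suc j * (2 * W),
        aux[ah := rd aux ah], mv ah 0 (length aux - 1), emit out None)
     \<and> stores (length x) w'' (T'(j := ?c'))"
    using Suc.prems nh ah by (intro cell_step_run[OF _ IH(2) _ _ _ _ _ cs]) (auto simp: shlt_def)
  then obtain w'' where one:
    "(sstep x ^^ (6 * W)) (Read [] (Scan q (left_nb c j) ?O), j, w', j * (2 * W), aux, ah, out)
     = (Read [] (Scan q (c j) (insert (insym x j, c j) ?O)), Suc j, w'', Suc j * (2 * W), aux, ah, out)"
    and st'': "stores (length x) w'' (T'(j := ?c'))"
    using ah by (auto simp: list_update_rd mv_0)
  have "?c' \<inter> {..<W} = c j" using c[of j] by auto
  then have "\<forall>p\<le>length x + 1. (T'(j := ?c')) p \<inter> {..<W} = c p" using IH(3) by simp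
  moreover have "\<forall>p<Suc j. (T'(j := ?c')) p = c p \<union> (+) W ` left_nb c p"
    using IH(4) by (auto simp: less_Suc_eq)
  moreover have "insert (insym x j, c j) ?O = (\<lambda>p. (insym x p, c p)) ` {..<Suc j}"
    "left_nb c (Suc j) = c j" "j * (6 * W) + 6 * W = Suc j * (6 * W)"
    by (simp_all add: lessThan_Suc left_nb_def)
  then have "(sstep x ^^ (Suc j * (6 * W))) (Read [] (Scan q {0} {}), 0, w, 0, aux, ah, out)
     = (Read [] (Scan q (left_nb c (Suc j)) ((\<lambda>p. (insym x p, c p)) ` {..<Suc j})), Suc j, w'',
        Suc j * (2 * W), aux, ah, out)"
    using funpow_chain[OF IH(1) one] by (simp only:)
  ultimately show ?case using st'' by blast
qed

text \<open>The last cell is visited with \<open>d = 0\<close> and visited again on the way back, so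
  each pass consists of \<open>length x + 2\<close> visits.\<close>

lemma Scan_turn:
  assumes c: "\<And>p. c p \<subseteq> {1..<W}" and nh: "\<not> hlt q" and ah: "ah \<le> length aux - 1"
    and st: "stores (length x) w T" "\<And>p. p \<le> length x + 1 \<Longrightarrow> T p \<inter> {..<W} = c p"
  shows "\<exists>w' T'. (sstep x ^^ ((length x + 2) * (6 * W)))
       (Read [] (Scan q {0} {}), 0, w, 0, aux, ah, out)
     = (Read [] (Back q (view x c) {}), length x + 1, w', (length x + 1) * (2 * W), aux, ah, out)
     \<and> stores (length x) w' T' \<and> (\<forall>p\<le>length x + 1. T' p = c p \<union> (+) W ` left_nb c p)"
proof -
  let ?n = "length x"
  let ?O = "(\<lambda>p. (insym x p, c p)) ` {..<?n + 1}"
  obtain w' T' where 1: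
    "(sstep x ^^ ((?n + 1) * (6 * W))) (Read [] (Scan q {0} {}), 0, w, 0, aux, ah, out)
     = (Read [] (Scan q (left_nb c (?n + 1)) ?O), ?n + 1, w', (?n + 1) * (2 * W), aux, ah, out)"
    "stores ?n w' T'" "\<forall>p\<le>?n + 1. T' p \<inter> {..<W} = c p"
    "\<forall>p<?n + 1. T' p = c p \<union> (+) W ` left_nb c p"
    using Scan_sweep[where j = "?n + 1", OF c nh ah st order_refl] by blast
  let ?c' = "c (?n + 1) \<union> (+) W ` left_nb c (?n + 1)"
  have view: "insert (insym x (?n + 1), c (?n + 1)) ?O = view x c"
    by (simp add: view_def atMost_Suc lessThan_Suc_atMost)
  have "insym x (?n + 1) = None" by (simp add: insym_def)
  moreover have "0 \<notin> left_nb c (?n + 1)" using c[of ?n] by (auto simp: left_nb_def)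
  moreover have "T' (?n + 1) \<inter> {..<W} = c (?n + 1)" using 1(3) by simp
  ultimately have cs: "cell_step (Scan q (left_nb c (?n + 1)) ?O) (insym x (?n + 1)) (T' (?n + 1)) (rd aux ah)
      = (Back q (view x c) {}, ?c', 0, rd aux ah, 0, None)"
    unfolding view[symmetric] by (simp add: cell_step_def Let_def)
  have "\<exists>w''. (sstep x ^^ (6 * W))
       (Read [] (Scan q (left_nb c (?n + 1)) ?O), ?n + 1, w', (?n + 1) * (2 * W), aux, ah, out)
     = (Read [] (Back q (view x c) {}), ?n + 1, w'', (?n + 1) * (2 * W),
        aux[ah := rd aux ah], mv ah 0 (length aux - 1), emit out None)
     \<and> stores ?n w'' (T'(?n + 1 := ?c'))"
    using nh ah by (intro cell_step_run[OF _ 1(2) _ _ _ _ _ cs]) (auto simp: shlt_def)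
  then obtain w'' where one: "(sstep x ^^ (6 * W))
       (Read [] (Scan q (left_nb c (?n + 1)) ?O), ?n + 1, w', (?n + 1) * (2 * W), aux, ah, out)
     = (Read [] (Back q (view x c) {}), ?n + 1, w'', (?n + 1) * (2 * W), aux, ah, out)"
    and st'': "stores ?n w'' (T'(?n + 1 := ?c'))"
    using ah by (auto simp: list_update_rd mv_0)
  have "\<forall>p\<le>?n + 1. (T'(?n + 1 := ?c')) p = c p \<union> (+) W ` left_nb c p"
    using 1(4) by (auto simp: le_less)
  moreover have "(?n + 1) * (6 * W) + 6 * W = (?n + 2) * (6 * W)" by simp
  then have "(sstep x ^^ ((?n + 2) * (6 * W))) (Read [] (Scan q {0} {}), 0, w, 0, aux, ah, out)
     = (Read [] (Back q (view x c) {}), ?n + 1, w'', (?n + 1) * (2 * W), aux, ah, out)"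
    using funpow_chain[OF 1(1) one] by (simp only:)
  ultimately show ?thesis using st'' by blast
qed

lemma cell_step_Back:
  assumes c: "\<And>p. c p \<subseteq> {1..<W}" and T: "T = c p \<union> (+) W ` left_nb c p"
  shows "cell_step (Back q ob nxt) a T b =
    (if p = 0 then (case G q ob b of (q', act) \<Rightarrow>
         (Scan q' {0} {}, F q ob b (left_nb c p) (c p) nxt, 0, act))
     else (Back q ob (c p), F q ob b (left_nb c p) (c p) nxt, -1, b, 0, None))"
proof -
  have l: "left_nb c p \<subseteq> {..<W}" using c[of "p - 1"] W by (auto simp: left_nb_def)
  have "T \<inter> {..<W} = c p" using c[of p] T by auto
  moreover have "{i. i < W \<and> W + i \<in> T} = left_nb c p" using c[of p] T l by auto
  moreover have "0 \<in> left_nb c p \<longleftrightarrow> p = 0" using c[of "p - 1"] by (auto simp: left_nb_def)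
  ultimately show ?thesis by (auto simp: cell_step_def Let_def)
qed

text \<open>Although cells are overwritten in place, \<open>F\<close> sees old contents only: that
  of the right neighbour travels in the state, and that of the left neighbour was copied into the
  upper half by the scan. \<open>c (length x + 2) = {}\<close> stands in for the missing right
  neighbour of the last cell.\<close>

lemma Back_sweep:
  assumes c: "\<And>p. c p \<subseteq> {1..<W}" "c (length x + 2) = {}" and ah: "ah \<le> length aux - 1"
    and st: "stores (length x) w T" "\<And>p. p \<le> length x + 1 \<Longrightarrow> T p = c p \<union> (+) W ` left_nb c p"
    and j: "j \<le> length x + 1"
  shows "\<exists>w' T'. (sstep x ^^ (j * (6 * W)))
       (Read [] (Back q ob {}), length x + 1, w, (length x + 1) * (2 * W), aux, ah, out)
     = (Read [] (Back q ob (c (length x + 2 - j))), length x + 1 - j, w',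
        (length x + 1 - j) * (2 * W), aux, ah, out)
     \<and> stores (length x) w' T' \<and> (\<forall>p\<le>length x + 1 - j. T' p = c p \<union> (+) W ` left_nb c p)
     \<and> (\<forall>p\<le>length x + 1. length x + 1 - j < p \<longrightarrow>
           T' p = F q ob (rd aux ah) (left_nb c p) (c p) (c (p + 1)))"
  using j
proof (induction j)
  case 0
  show ?case using st c(2) by auto
next
  case (Suc j)
  let ?n = "length x" and ?b = "rd aux ah"
  define p where "p = ?n + 1 - j"
  have p: "p > 0" "p \<le> ?n + 1" "?n + 1 - Suc j = p - 1" "?n + 2 - j = p + 1" "?n + 2 - Suc j = p"
    using Suc.prems by (auto simp: p_def)
  obtain w' T' where IH: "(sstep x ^^ (j * (6 * W)))
       (Read [] (Back q ob {}), ?n + 1, w, (?n + 1) * (2 * W), aux, ah, out)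
     = (Read [] (Back q ob (c (p + 1))), p, w', p * (2 * W), aux, ah, out)"
    "stores ?n w' T'" "\<forall>r\<le>p. T' r = c r \<union> (+) W ` left_nb c r"
    "\<forall>r\<le>?n + 1. p < r \<longrightarrow> T' r = F q ob ?b (left_nb c r) (c r) (c (r + 1))"
    using Suc p(4) unfolding p_def[symmetric] by (metis Suc_leD)
  let ?c' = "F q ob ?b (left_nb c p) (c p) (c (p + 1))"
  have cs: "cell_step (Back q ob (c (p + 1))) (insym x p) (T' p) ?b
      = (Back q ob (c p), ?c', -1, ?b, 0, None)"
    using cell_step_Back[of c "T' p" p, OF c(1)] IH(3) p(1) by simp
  have "\<exists>w''. (sstep x ^^ (6 * W)) (Read [] (Back q ob (c (p + 1))), p, w', p * (2 * W), aux, ah, out)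
     = (Read [] (Back q ob (c p)), p - 1, w'', (p - 1) * (2 * W),
        aux[ah := ?b], mv ah 0 (length aux - 1), emit out None)
     \<and> stores ?n w'' (T'(p := ?c'))"
    using ah p by (intro cell_step_run[OF _ IH(2) _ _ _ _ _ cs]) (auto simp: shlt_def)
  then obtain w'' where one:
    "(sstep x ^^ (6 * W)) (Read [] (Back q ob (c (p + 1))), p, w', p * (2 * W), aux, ah, out)
     = (Read [] (Back q ob (c p)), p - 1, w'', (p - 1) * (2 * W), aux, ah, out)"
    and st'': "stores ?n w'' (T'(p := ?c'))"
    using ah by (auto simp: list_update_rd mv_0)
  have "\<forall>r\<le>p - 1. (T'(p := ?c')) r = c r \<union> (+) W ` left_nb c r" using IH(3) p(1) by auto
  moreover have "\<forall>r\<le>?n + 1. p - 1 < r \<longrightarrow>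
      (T'(p := ?c')) r = F q ob ?b (left_nb c r) (c r) (c (r + 1))"
    using IH(4) p(1) by auto
  moreover have "j * (6 * W) + 6 * W = Suc j * (6 * W)" by simp
  then have "(sstep x ^^ (Suc j * (6 * W)))
       (Read [] (Back q ob {}), ?n + 1, w, (?n + 1) * (2 * W), aux, ah, out)
     = (Read [] (Back q ob (c p)), p - 1, w'', (p - 1) * (2 * W), aux, ah, out)"
    using funpow_chain[OF IH(1) one] by (simp only:)
  ultimately show ?case unfolding p(3,5) using st'' by blast
qed

section \<open>Whole rounds and the resulting machine\<close>

definition represents :: "bool list \<Rightarrow> 'q sconfig \<Rightarrow> 'q sstate tconfig \<Rightarrow> bool" where
  "represents x cf t = (case cf of (q, c, aux, ah, out) \<Rightarrow>
     (\<forall>p. c p \<subseteq> {1..<W}) \<and> c (length x + 2) = {} \<and> ah \<le> length aux - 1 \<and>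
     (\<exists>w T. t = (Read [] (Scan q {0} {}), 0, w, 0, aux, ah, out) \<and> stores (length x) w T \<and>
        (\<forall>p\<le>length x + 1. T p \<inter> {..<W} = c p)))"

text \<open>Two passes of \<open>length x + 2\<close> visits at \<open>6 * W\<close> steps each. In
  a halting state both sides stand still, so the same step count remains valid.\<close>

lemma round_run:
  assumes "represents x cf t"
  shows "represents x (sweep_round x cf) ((sstep x ^^ ((length x + 2) * (12 * W))) t)"
proof -
  let ?n = "length x"
  obtain q c aux ah out where cf: "cf = (q, c, aux, ah, out)" by (metis prod_cases5)
  obtain w T where t: "t = (Read [] (Scan q {0} {}), 0, w, 0, aux, ah, out)"
    and c: "\<And>p. c p \<subseteq> {1..<W}" "c (?n + 2) = {}" and ah: "ah \<le> length aux - 1"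
    and st: "stores ?n w T" "\<And>p. p \<le> ?n + 1 \<Longrightarrow> T p \<inter> {..<W} = c p"
    using assms by (auto simp: represents_def cf)
  show ?thesis
  proof (cases "hlt q")
    case True
    then have "sstep x t = t" by (simp add: tstep_def t shlt_def)
    then have "(sstep x ^^ m) t = t" for m by (induction m) auto
    then show ?thesis using assms True by (simp add: sweep_round_def cf)
  next
    case False
    let ?O = "view x c" and ?b = "rd aux ah"
    obtain q' aw am ob where G: "G q ?O ?b = (q', aw, am, ob)" by (metis prod_cases4)
    let ?c = "\<lambda>p. F q ?O ?b (left_nb c p) (c p) (c (p + 1))"
    obtain w1 T1 where 1: "(sstep x ^^ ((?n + 2) * (6 * W))) t
       = (Read [] (Back q ?O {}), ?n + 1, w1, (?n + 1) * (2 * W), aux, ah, out)"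
      "stores ?n w1 T1" "\<And>p. p \<le> ?n + 1 \<Longrightarrow> T1 p = c p \<union> (+) W ` left_nb c p"
      using Scan_turn[OF c(1) False ah st] unfolding t by blast
    obtain w2 T2 where 2: "(sstep x ^^ ((?n + 1) * (6 * W)))
         (Read [] (Back q ?O {}), ?n + 1, w1, (?n + 1) * (2 * W), aux, ah, out)
       = (Read [] (Back q ?O (c 1)), 0, w2, 0, aux, ah, out)"
      "stores ?n w2 T2" "T2 0 = c 0 \<union> (+) W ` left_nb c 0"
      "\<And>p. p \<le> ?n + 1 \<Longrightarrow> 0 < p \<Longrightarrow> T2 p = ?c p"
      using Back_sweep[where j = "?n + 1" and q = q and ob = ?O and out = out, OF c ah 1(2,3) order_refl]
      by auto
    have cs: "cell_step (Back q ?O (c 1)) (insym x 0) (T2 0) ?b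
        = (Scan q' {0} {}, ?c 0, 0, aw, am, ob)"
      using cell_step_Back[of c "T2 0" 0, OF c(1)] 2(3) G by simp
    have "\<exists>w3. (sstep x ^^ (6 * W)) (Read [] (Back q ?O (c 1)), 0, w2, 0 * (2 * W), aux, ah, out)
       = (Read [] (Scan q' {0} {}), 0, w3, 0 * (2 * W),
          aux[ah := aw], mv ah am (length aux - 1), emit out ob)
       \<and> stores ?n w3 (T2(0 := ?c 0))"
      using ah by (intro cell_step_run[OF _ 2(2) _ _ _ _ _ cs]) (auto simp: shlt_def)
    then obtain w3 where 3:
      "(sstep x ^^ (6 * W)) (Read [] (Back q ?O (c 1)), 0, w2, 0, aux, ah, out)
       = (Read [] (Scan q' {0} {}), 0, w3, 0, aux[ah := aw], mv ah am (length aux - 1), emit out ob)"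
      "stores ?n w3 (T2(0 := ?c 0))"
      by auto
    have "(?n + 2) * (12 * W) = (?n + 2) * (6 * W) + (?n + 1) * (6 * W) + 6 * W" by simp
    then have fin: "(sstep x ^^ ((?n + 2) * (12 * W))) t
       = (Read [] (Scan q' {0} {}), 0, w3, 0, aux[ah := aw], mv ah am (length aux - 1), emit out ob)"
      using funpow_chain[OF funpow_chain[OF 1(1) 2(1)] 3(1)] by metis
    define T3 where "T3 = T2(0 := ?c 0)"
    have "T3 p \<inter> {..<W} = ?c p" if "p \<le> ?n + 1" for p
    proof -
      have "T3 p = ?c p" using that 2(4)[of p] by (cases "p = 0") (auto simp: T3_def)
      moreover have "?c p \<subseteq> {1..<W}" by (rule F_range)
      ultimately show ?thesis by auto
    qed
    then have T3: "\<forall>p\<le>?n + 1. T3 p \<inter> {..<W} = (if p \<le> ?n + 1 then ?c p else {})"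
      by simp
    have "sweep_round x cf = (q', \<lambda>p. if p \<le> ?n + 1 then ?c p else {},
        aux[ah := aw], mv ah am (length aux - 1), emit out ob)"
      using False G by (simp add: sweep_round_def cf)
    moreover have "represents x (q', \<lambda>p. if p \<le> ?n + 1 then ?c p else {},
        aux[ah := aw], mv ah am (length aux - 1), emit out ob)
      (Read [] (Scan q' {0} {}), 0, w3, 0, aux[ah := aw], mv ah am (length aux - 1), emit out ob)"
      unfolding represents_def prod.case length_list_update
    proof (intro conjI allI exI[of _ w3] exI[of _ T3] refl)
      show "(if p \<le> ?n + 1 then ?c p else {}) \<subseteq> {1..<W}" for p using F_range by simp
      show "stores ?n w3 T3" using 3(2) by (simp add: T3_def)
    qed (use T3 mv_le in auto)
    ultimately show ?thesis unfolding fin by simp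
  qed
qed

definition init_sweep :: "bool list \<Rightarrow> 'q sconfig" where
  "init_sweep aux = (q0, \<lambda>_. {}, aux, 0, [])"

lemma rounds_run:
  assumes "(length x + 2) * (2 * W) \<le> wl"
  shows "represents x ((sweep_round x ^^ t) (init_sweep aux))
    ((sstep x ^^ (t * ((length x + 2) * (12 * W))))
      (Read [] (Scan q0 {0} {}), 0, replicate wl False, 0, aux, 0, []))"
proof (induction t)
  case 0
  have "stores (length x) (replicate wl False) (\<lambda>_. {})"
    unfolding stores_def
  proof (intro conjI allI impI)
    show "(length x + 2) * (2 * W) \<le> length (replicate wl False)" using assms by simp
    fix p i assume pi: "p \<le> length x + 1" "i < 2 * W"
    have "p * (2 * W) + i < (p + 1) * (2 * W)" using pi by simp
    also have "\<dots> \<le> (length x + 2) * (2 * W)" using pi by (intro mult_right_mono) auto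
    finally have "p * (2 * W) + i < wl" using assms by simp
    then show "replicate wl False ! (p * (2 * W) + i) = (i \<in> {})" by simp
  qed
  then show ?case by (auto simp: represents_def init_sweep_def)
next
  case (Suc t)
  have "Suc t * ((length x + 2) * (12 * W)) = t * ((length x + 2) * (12 * W)) + (length x + 2) * (12 * W)"
    by simp
  then show ?case using round_run[OF Suc] by (simp only: funpow_comp) simp
qed

lemma sweep_automaton_machine:
  "\<exists>M. wf_machine M \<and> (\<forall>x wl aux t q c aux' ah out.
     (length x + 2) * (2 * W) \<le> wl \<and> (sweep_round x ^^ t) (init_sweep aux) = (q, c, aux', ah, out) \<and> hlt q \<longrightarrow>
     halting M (cstate (run M x wl aux (t * ((length x + 2) * (12 * W))))) \<and>
     cout (run M x wl aux (t * ((length x + 2) * (12 * W)))) = out)"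
proof -
  let ?s = "Read [] (Scan q0 {0} {})"
  have "?s \<in> sstates" using q0 W by simp
  then obtain M where M: "wf_machine M" "\<And>x wl aux t.
      let cf = (sstep x ^^ t) (?s, 0, replicate wl False, 0, aux, 0, []) in
      halting M (cstate (run M x wl aux t)) = shlt (fst cf) \<and>
      cout (run M x wl aux t) = snd (snd (snd (snd (snd (snd cf)))))"
    using machine_of_trans[OF finite_sstates, of ?s sdelta shlt] sdelta_closed by metis
  show ?thesis
  proof (intro exI[of _ M] conjI M(1) allI impI; elim conjE)
    fix x wl aux t q c aux' ah out
    assume "(length x + 2) * (2 * W) \<le> wl" "(sweep_round x ^^ t) (init_sweep aux) = (q, c, aux', ah, out)" "hlt q"
    then show "halting M (cstate (run M x wl aux (t * ((length x + 2) * (12 * W)))))"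
      "cout (run M x wl aux (t * ((length x + 2) * (12 * W)))) = out"
      using rounds_run[where x = x and wl = wl and t = t and aux = aux] M(2)[where x = x and wl = wl and aux = aux and t = "t * ((length x + 2) * (12 * W))"]
      by (auto simp: represents_def Let_def shlt_def)
  qed
qed

end

section \<open>The simulator as a sweep automaton\<close>

text \<open>Little-endian base-\<open>n\<close> value. Positions run over the cells
  \<open>1..n\<close>, hence the subtraction of \<open>1\<close>.\<close>

definition odo :: "nat \<Rightarrow> (nat \<Rightarrow> nat) \<Rightarrow> nat \<Rightarrow> nat" where
  "odo n u l = (\<Sum>i<l. (u i - 1) * n ^ i)"

lemma odo_less:
  assumes "n > 0" "\<And>i. i < l \<Longrightarrow> u i \<le> n"
  shows "odo n u l < n ^ l"
  using assms(2)
proof (induction l)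
  case (Suc l)
  have "(u l - 1) * n ^ l \<le> (n - 1) * n ^ l" using Suc.prems[of l] by (intro mult_right_mono) auto
  moreover have "odo n u l < n ^ l" using Suc by simp
  moreover have "odo n u (Suc l) = odo n u l + (u l - 1) * n ^ l" by (simp add: odo_def)
  ultimately have "odo n u (Suc l) < n ^ l + (n - 1) * n ^ l" by linarith
  also have "\<dots> = n ^ Suc l" using assms(1) by (cases n) auto
  finally show ?case .
qed (simp add: odo_def)

text \<open>A digit changes exactly when all digits below it are largest. The term
  \<open>n ^ l\<close> accounts for the overflow of the first \<open>l\<close> digits and becomes
  the carry into digit \<open>l\<close> in the induction.\<close>

lemma odo_inc:
  assumes "n > 0" "\<And>i. i < l \<Longrightarrow> 1 \<le> u i \<and> u i \<le> n"
    "\<And>i. i < l \<Longrightarrow> u' i = (if \<forall>m<i. u m = n then (if u i = n then 1 else u i + 1) else u i)"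
  shows "odo n u' l + (if \<forall>i<l. u i = n then n ^ l else 0) = odo n u l + 1"
  using assms(2,3)
proof (induction l)
  case (Suc l)
  have IH: "odo n u' l + (if \<forall>i<l. u i = n then n ^ l else 0) = odo n u l + 1"
    using Suc by simp
  have ul: "1 \<le> u l" "u l \<le> n" using Suc.prems(1)[of l] by auto
  have u': "u' l = (if \<forall>m<l. u m = n then (if u l = n then 1 else u l + 1) else u l)"
    using Suc.prems(2)[of l] by simp
  have nn: "n ^ l + (n - 1) * n ^ l = n * n ^ l" using assms(1) by (cases n) auto
  have uu: "n ^ l + (u l - 1) * n ^ l = u l * n ^ l" using ul(1) by (cases "u l") auto
  show ?case using IH u' nn uu
    by (cases "\<forall>i<l. u i = n"; cases "u l = n") (auto simp: odo_def less_Suc_eq)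
qed (simp add: odo_def)

lemma odo_dec:
  assumes "n > 0" "\<And>i. i < l \<Longrightarrow> 1 \<le> u i \<and> u i \<le> n"
    "\<And>i. i < l \<Longrightarrow> u' i = (if \<forall>m<i. u m = 1 then (if u i = 1 then n else u i - 1) else u i)"
  shows "odo n u' l + 1 = odo n u l + (if \<forall>i<l. u i = 1 then n ^ l else 0)"
  using assms(2,3)
proof (induction l)
  case (Suc l)
  have IH: "odo n u' l + 1 = odo n u l + (if \<forall>i<l. u i = 1 then n ^ l else 0)"
    using Suc by simp
  have ul: "1 \<le> u l" using Suc.prems(1)[of l] by auto
  have u': "u' l = (if \<forall>m<l. u m = 1 then (if u l = 1 then n else u l - 1) else u l)"
    using Suc.prems(2)[of l] by simp
  have nn: "n ^ l + (n - 1) * n ^ l = n * n ^ l" using assms(1) by (cases n) auto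
  have uu: "u l \<noteq> 1 \<Longrightarrow> n ^ l + (u l - 1 - 1) * n ^ l = (u l - 1) * n ^ l"
    using ul by (cases "u l - 1") auto
  show ?case using IH u' nn uu
    by (cases "\<forall>i<l. u i = 1"; cases "u l = 1") (auto simp: odo_def less_Suc_eq)
qed (simp add: odo_def)

text \<open>The incremented value of \<open>odo_inc\<close> stays below \<open>n ^ l\<close>, so its
  overflow term is present exactly when the old value is \<open>n ^ l - 1\<close>.\<close>

lemma odo_max_iff:
  assumes "n > 0" "\<And>i. i < l \<Longrightarrow> 1 \<le> u i \<and> u i \<le> n"
  shows "(\<forall>i<l. u i = n) \<longleftrightarrow> odo n u l + 1 = n ^ l"
proof -
  define u' where "u' i = (if \<forall>m<i. u m = n then (if u i = n then 1 else u i + 1) else u i)" for i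
  have "odo n u' l + (if \<forall>i<l. u i = n then n ^ l else 0) = odo n u l + 1"
    by (rule odo_inc[OF assms u'_def])
  moreover have "odo n u' l < n ^ l"
  proof (rule odo_less[OF assms(1)])
    show "u' i \<le> n" if "i < l" for i using assms(2)[OF that] by (auto simp: u'_def)
  qed
  moreover have "odo n u l < n ^ l" using assms by (intro odo_less) auto
  ultimately show ?thesis by (auto split: if_splits)
qed

lemma odo_min_iff:
  assumes "n > 1" "\<And>i. i < l \<Longrightarrow> 1 \<le> u i \<and> u i \<le> n"
  shows "(\<forall>i<l. u i = 1) \<longleftrightarrow> odo n u l = 0"
  using assms by (force simp: odo_def)

text \<open>By the first two bounds, repeated doubling from \<open>1\<close> reaches
  \<open>n\<close> after exactly \<open>L\<close> rounds. The next two make \<open>L\<close> a cell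
  of the input, and the last makes the number of work tape contents polynomial.\<close>

lemma log_ceiling_bounds:
  fixes n :: nat
  assumes "2 \<le> n" and L: "L = nat \<lceil>log 2 (real n)\<rceil>"
  shows "n \<le> 2 ^ L" "\<And>i. i < L \<Longrightarrow> 2 ^ i < n" "1 \<le> L" "L \<le> n" "2 ^ L < 2 * n"
proof -
  have nn: "0 \<le> log 2 (real n)" using assms by simp
  then have "log 2 (real n) \<le> real L" unfolding L by linarith
  then have "2 powr log 2 (real n) \<le> 2 powr real L" by (intro powr_mono) auto
  then have "real n \<le> real (2 ^ L)" using assms(1) by (simp add: powr_realpow)
  then show 1: "n \<le> 2 ^ L" by (simp only: of_nat_le_iff)
  show 2: "2 ^ i < n" if "i < L" for i
  proof -
    have "real i < log 2 (real n)" using that unfolding L by linarith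
    then have "2 powr real i < 2 powr log 2 (real n)" by (intro powr_less_mono) auto
    then have "real (2 ^ i) < real n" using assms(1) by (simp add: powr_realpow)
    then show ?thesis by (simp only: of_nat_less_iff)
  qed
  show 3: "1 \<le> L" using 1 assms(1) by (cases L) auto
  show "L \<le> n" using 2[of "L - 1"] 3 less_exp[of "L - 1"] by linarith
  show "2 ^ L < 2 * n" using 2[of "L - 1"] 3 by (cases L) auto
qed

text \<open>Tracks of the simulator. A head is a track that is set in exactly one cell. The heads are
  2: cell \<open>0\<close>; 3: cell \<open>1\<close>; 4: cell \<open>n\<close>; 5, 6: scratch for doubling; 7: cell \<open>L = \<lceil>log\<^sub>2 n\<rceil>\<close>;
  8: input head; 9: work head; \<open>10..<10+k\<close>: base-\<open>n\<close> digits of the catalytic head position;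
  \<open>10+k..<10+k+a\<close>: base-\<open>n\<close> digits of a clock. A digit \<open>d\<close> is a head in cell \<open>d+1\<close>. Track
  \<open>10+k+a+j\<close> of cell \<open>p+1\<close> holds bit \<open>p*k+j\<close> of the work tape, whose head has \<open>j\<close> in the state.\<close>

datatype pstate = Boot | Spread | First | FindEnd | LogTest | LogAdd | Sim nat nat | Halt

section \<open>The program of the simulator\<close>

definition meet :: "obs \<Rightarrow> nat \<Rightarrow> nat \<Rightarrow> bool" where
  "meet ob g h \<longleftrightarrow> (\<exists>(s, c)\<in>ob. g \<in> c \<and> h \<in> c)"

definition symbol_at :: "obs \<Rightarrow> nat \<Rightarrow> bool option" where
  "symbol_at ob h = (THE s. \<exists>c. (s, c) \<in> ob \<and> h \<in> c)"

text \<open>A pair \<open>(g, d)\<close> assigned to a head sends it to where head \<open>g\<close>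
  is now, shifted by \<open>d\<close>. Copying from head \<open>3\<close> or \<open>4\<close> thus
  resets a digit to its smallest or largest value in one round.\<close>

definition stay :: "nat \<Rightarrow> nat \<times> int" where
  "stay h = (h, 0)"

definition inc_move :: "obs \<Rightarrow> nat \<Rightarrow> nat \<Rightarrow> nat \<times> int" where
  "inc_move ob s i = (if \<forall>m<i. meet ob (s + m) 4
     then (if meet ob (s + i) 4 then (3, 0) else (s + i, 1)) else (s + i, 0))"

definition dec_move :: "obs \<Rightarrow> nat \<Rightarrow> nat \<Rightarrow> nat \<times> int" where
  "dec_move ob s i = (if \<forall>m<i. meet ob (s + m) 3
     then (if meet ob (s + i) 3 then (4, 0) else (s + i, -1)) else (s + i, 0))"

locale simulation =
  fixes M :: machine and k a :: nat and ans :: "bool list \<Rightarrow> bool"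
  assumes wf: "wf_machine M"
begin

definition heads :: "nat set" where "heads = {2..<10 + k + a}"

definition dat :: "nat \<Rightarrow> nat" where "dat j = 10 + k + a + j"

text \<open>Meeting head \<open>2\<close>, which stays in cell \<open>0\<close>, identifies the left
  end-marker among the two.\<close>

definition input_dir :: "obs \<Rightarrow> int \<Rightarrow> int" where
  "input_dir ob d = (if d > 0 then (if symbol_at ob 8 = None \<and> \<not> meet ob 8 2 then 0 else 1)
     else if d < 0 then (if meet ob 8 2 then 0 else -1) else 0)"

text \<open>The \<open>k * L\<close> bits are cut into \<open>L\<close> blocks of \<open>k\<close>
  bits, because the number of tracks must be constant. Head \<open>9\<close> moves only across block
  borders; heads \<open>3\<close> and \<open>7\<close> show the first and the last block.\<close>

definition work_move :: "obs \<Rightarrow> nat \<Rightarrow> int \<Rightarrow> nat \<times> int" where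
  "work_move ob j d =
    (if d > 0 then (if j + 1 < k then (j + 1, 0) else if meet ob 9 7 then (j, 0) else (0, 1))
     else if d < 0 then (if j > 0 then (j - 1, 0) else if meet ob 9 3 then (j, 0) else (k - 1, -1))
     else (j, 0))"

definition cat_move :: "obs \<Rightarrow> int \<Rightarrow> nat \<Rightarrow> nat \<times> int" where
  "cat_move ob d i =
    (if d > 0 \<and> \<not> (\<forall>m<k. meet ob (10 + m) 4) then inc_move ob 10 i
     else if d < 0 \<and> \<not> (\<forall>m<k. meet ob (10 + m) 3) then dec_move ob 10 i
     else (10 + i, 0))"

definition sim_move :: "obs \<Rightarrow> int \<Rightarrow> int \<Rightarrow> int \<Rightarrow> nat \<Rightarrow> nat \<times> int" where
  "sim_move ob di dp dc h =
    (if h = 8 then (8, input_dir ob di) else if h = 9 then (9, dp)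
     else if 10 \<le> h \<and> h < 10 + k then cat_move ob dc (h - 10)
     else if 10 + k \<le> h then inc_move ob (10 + k) (h - (10 + k))
     else (h, 0))"

text \<open>\<open>LogTest\<close> and \<open>LogAdd\<close> double head \<open>5\<close> until it
  meets head \<open>4\<close> in cell \<open>n\<close>, while head \<open>7\<close> counts the
  doublings and head \<open>6\<close> holds the summand and counts down. In \<open>Sim\<close> the
  random tape may extend beyond the simulated catalytic tape, hence the explicit stop at the maximal
  head position; at the left end the real tape stops the head.\<close>

definition act :: "pstate \<Rightarrow> obs \<Rightarrow> bool \<Rightarrow>
    pstate \<times> (nat \<Rightarrow> nat \<times> int) \<times> (nat \<times> bool) option \<times> bool \<times> int \<times> bool option" where
  "act q ob b = (case q of
     Boot \<Rightarrow> (Spread, stay, None, b, 0, None)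
   | Spread \<Rightarrow> (First, \<lambda>h. (h, if h \<in> {2, 7, 8} then 0 else 1), None, b, 0, None)
   | First \<Rightarrow> if symbol_at ob 3 = None then (Halt, stay, None, b, 0, Some (ans []))
       else (FindEnd, stay(4 := (4, 1)), None, b, 0, None)
   | FindEnd \<Rightarrow> if symbol_at ob 4 = None then (LogTest, stay(4 := (4, -1)), None, b, 0, None)
       else (FindEnd, stay(4 := (4, 1)), None, b, 0, None)
   | LogTest \<Rightarrow> if meet ob 4 3 then (Halt, stay, None, b, 0, Some (ans [the (symbol_at ob 3)]))
       else if meet ob 5 4 then (Sim 0 0, stay, None, b, 0, None)
       else (LogAdd, stay(7 := (7, 1), 6 := (5, 0)), None, b, 0, None)
   | LogAdd \<Rightarrow> if meet ob 6 2 then (LogTest, stay, None, b, 0, None)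
       else (LogAdd, stay(6 := (6, -1), 5 := (5, if meet ob 5 4 then 0 else 1)), None, b, 0, None)
   | Sim s j \<Rightarrow> if \<forall>i<a. meet ob (10 + k + i) 4 then (Halt, stay, None, b, 0, None)
       else (case delta M s (symbol_at ob 8) (j < k \<and> meet ob 9 (dat j)) b of
         (s', di, ww, dw, cw, dc, o') \<Rightarrow>
           (Sim s' (fst (work_move ob j dw)), sim_move ob di (snd (work_move ob j dw)) dc,
            Some (j, ww), cw, if dc > 0 \<and> (\<forall>m<k. meet ob (10 + m) 4) then 0 else dc, o'))
   | Halt \<Rightarrow> (Halt, stay, None, b, 0, None))"

text \<open>Moves are seen from the receiving cell: a head arrives if its source is here, in the
  left neighbour or in the right one. In \<open>Boot\<close> the reserved index \<open>0\<close>
  singles out cell \<open>0\<close>, where all heads are created.\<close>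

definition prog_F :: "pstate \<Rightarrow> obs \<Rightarrow> bool \<Rightarrow> nat set \<Rightarrow> nat set \<Rightarrow> nat set \<Rightarrow> nat set" where
  "prog_F q ob b l m r = (if q = Boot then (if 0 \<in> l then heads else {}) else
     (case act q ob b of (q', mvs, wr, _) \<Rightarrow>
       {h \<in> heads. fst (mvs h) \<in> (if snd (mvs h) = 0 then m else if snd (mvs h) > 0 then l else r)}
       \<union> dat ` {j. j < k \<and> (case wr of None \<Rightarrow> dat j \<in> m
            | Some (j', v) \<Rightarrow> if j = j' \<and> 9 \<in> m then v else dat j \<in> m)}))"

definition prog_G :: "pstate \<Rightarrow> obs \<Rightarrow> bool \<Rightarrow> pstate \<times> bool \<times> int \<times> bool option" where
  "prog_G q ob b = (case act q ob b of (q', mvs, wr, rest) \<Rightarrow> (q', rest))"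

definition prog_hlt :: "pstate \<Rightarrow> bool" where
  "prog_hlt q = (case q of Halt \<Rightarrow> True | Sim s j \<Rightarrow> halting M s | _ \<Rightarrow> False)"

text \<open>The range \<open>{..k}\<close> admits \<open>j = 0\<close> even if
  \<open>k = 0\<close>.\<close>

definition prog_states :: "pstate set" where
  "prog_states = {Boot, Spread, First, FindEnd, LogTest, LogAdd, Halt} \<union>
     (\<lambda>(s, j). Sim s j) ` ({..<nstates M} \<times> {..k})"

sublocale sweep_automaton "10 + 2 * k + a" prog_F prog_G prog_hlt prog_states Boot
proof
  fix q ob b assume q: "q \<in> prog_states"
  show "fst (prog_G q ob b) \<in> prog_states"
  proof (cases "\<exists>s j. q = Sim s j")
    case True
    then obtain s j where s: "q = Sim s j" "s < nstates M" "j \<le> k" using q by (auto simp: prog_states_def)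
    obtain s' di ww dw cw dc o' where
      d: "delta M s (symbol_at ob 8) (j < k \<and> meet ob 9 (dat j)) b = (s', di, ww, dw, cw, dc, o')"
      by (metis prod_cases7)
    have "s' < nstates M" using wf s d unfolding wf_machine_def by (metis fst_conv)
    moreover have "fst (work_move ob j dw) \<le> k" using s(3) by (auto simp: work_move_def)
    ultimately show ?thesis using s d by (auto simp: prog_G_def act_def prog_states_def)
  next
    case False
    moreover have "0 < nstates M" using wf by (simp add: wf_machine_def)
    ultimately show ?thesis using q by (auto simp: prog_G_def act_def prog_states_def)
  qed
next
  show "prog_F q ob b l m r \<subseteq> {1..<10 + 2 * k + a}" for q ob b l m r
  proof -
    have "heads \<union> dat ` {..<k} \<subseteq> {1..<10 + 2 * k + a}" by (auto simp: heads_def dat_def)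
    moreover have "prog_F q ob b l m r \<subseteq> heads \<union> dat ` {..<k}"
      unfolding prog_F_def by (cases "act q ob b") auto
    ultimately show ?thesis by (rule order_trans[rotated])
  qed
qed (auto simp: prog_states_def)

section \<open>Rounds as assignments to head positions\<close>

definition enc :: "nat \<Rightarrow> (nat \<Rightarrow> nat) \<Rightarrow> (nat \<Rightarrow> nat \<Rightarrow> bool) \<Rightarrow> nat \<Rightarrow> nat set" where
  "enc n v D p = (if p \<le> n + 1 then {h \<in> heads. v h = p} \<union> dat ` {j. j < k \<and> D p j} else {})"

lemma dat_notin_heads: "dat j \<notin> heads" by (simp add: dat_def heads_def)

lemma dat_inj: "dat i = dat j \<longleftrightarrow> i = j" by (simp add: dat_def)

lemma mem_enc:
  "h \<in> heads \<Longrightarrow> h \<in> enc n v D p \<longleftrightarrow> p \<le> n + 1 \<and> v h = p"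
  "j < k \<Longrightarrow> dat j \<in> enc n v D p \<longleftrightarrow> p \<le> n + 1 \<and> D p j"
  using dat_notin_heads by (auto simp: enc_def dat_inj)

lemma meet_heads:
  assumes "g \<in> heads" "h \<in> heads" "v g \<le> length x + 1"
  shows "meet (view x (enc (length x) v D)) g h \<longleftrightarrow> v g = v h"
  using assms by (auto simp: meet_def view_def mem_enc)

lemma meet_dat:
  assumes "g \<in> heads" "j < k" "v g \<le> length x + 1"
  shows "meet (view x (enc (length x) v D)) g (dat j) \<longleftrightarrow> D (v g) j"
  using assms by (auto simp: meet_def view_def mem_enc)

lemma symbol_at_head:
  assumes "h \<in> heads" "v h \<le> length x + 1"
  shows "symbol_at (view x (enc (length x) v D)) h = insym x (v h)"
  unfolding symbol_at_def by (rule the_equality) (use assms in \<open>auto simp: view_def mem_enc\<close>)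

text \<open>Sets turn into arithmetic here: a round is a simultaneous assignment to the positions
  \<open>v\<close>. Every source head differs from the reserved index \<open>0\<close>, so the
  virtual neighbour of cell \<open>0\<close> never supplies a head.\<close>

lemma sweep_round_enc:
  fixes D :: "nat \<Rightarrow> nat \<Rightarrow> bool"
  assumes q: "q \<noteq> Boot" "\<not> prog_hlt q"
    and v: "\<And>h. h \<in> heads \<Longrightarrow> v h \<le> length x + 1"
    and act: "act q (view x (enc (length x) v D)) (rd aux ah) = (q', mvs, wr, aw, am, ob)"
    and mvs: "\<And>h. h \<in> heads \<Longrightarrow> fst (mvs h) \<in> heads \<and> snd (mvs h) \<in> {-1, 0, 1} \<and>
         int (v' h) = int (v (fst (mvs h))) + snd (mvs h)"
    and D': "\<And>p j. j < k \<Longrightarrow> D' p j = (case wr of None \<Rightarrow> D p j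
         | Some (j', y) \<Rightarrow> if j = j' \<and> p = v 9 then y else D p j)"
  shows "sweep_round x (q, enc (length x) v D, aux, ah, out)
    = (q', enc (length x) v' D', aux[ah := aw], mv ah am (length aux - 1), emit out ob)"
proof -
  let ?n = "length x"
  let ?c = "enc ?n v D" and ?b = "rd aux ah"
  have "prog_F q (view x ?c) ?b (left_nb ?c p) (?c p) (?c (p + 1)) = enc ?n v' D' p"
    if p: "p \<le> ?n + 1" for p
  proof -
    have "{h \<in> heads. fst (mvs h) \<in> (if snd (mvs h) = 0 then ?c p
        else if snd (mvs h) > 0 then left_nb ?c p else ?c (p + 1))} = {h \<in> heads. v' h = p}"
    proof (intro Collect_cong conj_cong refl)
      fix h assume h: "h \<in> heads"
      note m = mvs[OF h]
      let ?g = "fst (mvs h)"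
      have vg: "v ?g \<le> ?n + 1" using v m by blast
      have g0: "?g \<noteq> 0" using m by (auto simp: heads_def)
      consider "snd (mvs h) = 0" | "snd (mvs h) = 1" | "snd (mvs h) = -1" using m by auto
      then show "?g \<in> (if snd (mvs h) = 0 then ?c p
        else if snd (mvs h) > 0 then left_nb ?c p else ?c (p + 1)) \<longleftrightarrow> v' h = p"
      proof cases
        case 1
        then show ?thesis using m p by (simp add: mem_enc)
      next
        case 2
        then show ?thesis using m p g0 by (cases p) (auto simp: mem_enc left_nb_def)
      next
        case 3
        then show ?thesis using m p vg by (auto simp: mem_enc)
      qed
    qed
    moreover have "{j. j < k \<and> (case wr of None \<Rightarrow> dat j \<in> ?c p
            | Some (j', y) \<Rightarrow> if j = j' \<and> 9 \<in> ?c p then y else dat j \<in> ?c p)}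
        = {j. j < k \<and> D' p j}"
      using p by (intro Collect_cong conj_cong refl)
        (auto simp: D' mem_enc heads_def split: option.splits)
    moreover have "enc ?n v' D' p = {h \<in> heads. v' h = p} \<union> dat ` {j. j < k \<and> D' p j}"
      using p by (simp add: enc_def)
    ultimately show ?thesis by (simp only: prog_F_def act q prod.case if_False)
  qed
  then have "(\<lambda>p. if p \<le> ?n + 1 then prog_F q (view x ?c) ?b (left_nb ?c p) (?c p) (?c (p + 1)) else {})
     = enc ?n v' D'"
    by (auto simp: enc_def fun_eq_iff)
  then show ?thesis using q act by (simp add: sweep_round_def prog_G_def)
qed

definition reach :: "bool list \<Rightarrow> nat \<Rightarrow> pstate sconfig \<Rightarrow> pstate sconfig \<Rightarrow> bool" where
  "reach x b cf cf' \<longleftrightarrow> (\<exists>m\<le>b. (sweep_round x ^^ m) cf = cf')"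

lemma reach_trans: "reach x b cf cf' \<Longrightarrow> reach x b' cf' cf'' \<Longrightarrow> b + b' \<le> b'' \<Longrightarrow> reach x b'' cf cf''"
proof -
  assume "reach x b cf cf'" "reach x b' cf' cf''" and b: "b + b' \<le> b''"
  then obtain m m' where "m \<le> b" "(sweep_round x ^^ m) cf = cf'" "m' \<le> b'" "(sweep_round x ^^ m') cf' = cf''"
    by (auto simp: reach_def)
  then show ?thesis using b funpow_chain[of m "sweep_round x" cf cf' m' cf'']
    unfolding reach_def by (intro exI[of _ "m + m'"]) simp
qed

lemma reach_round: "sweep_round x cf = cf' \<Longrightarrow> reach x 1 cf cf'"
  unfolding reach_def by (rule exI[of _ 1]) simp

lemma reach_mono: "reach x b cf cf' \<Longrightarrow> b \<le> b' \<Longrightarrow> reach x b' cf cf'"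
  unfolding reach_def using le_trans by blast

lemma head_mem [simp]: "2 \<in> heads" "3 \<in> heads" "4 \<in> heads" "5 \<in> heads" "6 \<in> heads"
  "7 \<in> heads" "8 \<in> heads" "9 \<in> heads"
  by (simp_all add: heads_def)

section \<open>Locating the cells \<open>n\<close> and \<open>L\<close>\<close>

abbreviation blank :: "nat \<Rightarrow> nat \<Rightarrow> bool" where "blank \<equiv> \<lambda>_ _. False"

text \<open>Cell \<open>0\<close> is the start of the input head and the zero of counter
  \<open>7\<close>. Cell \<open>1\<close> is at once digit \<open>0\<close>, the first work block
  and the number \<open>1\<close> to be doubled.\<close>

definition spread :: "nat \<Rightarrow> nat" where "spread h = (if h \<in> {2, 7, 8} then 0 else 1)"

lemma quiet_round:
  assumes "q \<noteq> Boot" "\<not> prog_hlt q" "\<And>h. h \<in> heads \<Longrightarrow> v h \<le> length x + 1"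
    "ah \<le> length aux - 1"
    and "act q (view x (enc (length x) v D)) (rd aux ah) = (q', mvs, None, rd aux ah, 0, ob)"
    and "\<And>h. h \<in> heads \<Longrightarrow> fst (mvs h) \<in> heads \<and> snd (mvs h) \<in> {-1, 0, 1} \<and>
         int (v' h) = int (v (fst (mvs h))) + snd (mvs h)"
  shows "sweep_round x (q, enc (length x) v D, aux, ah, out)
    = (q', enc (length x) v' D, aux, ah, emit out ob)"
  using sweep_round_enc[OF assms(1,2,3,5,6), of D] assms(4) by (simp add: list_update_rd mv_0)

lemma round_Boot:
  "sweep_round x (Boot, \<lambda>_. {}, aux, 0, []) = (Spread, enc (length x) (\<lambda>_. 0) blank, aux, 0, [])"
proof -
  have "(\<lambda>p. if p \<le> length x + 1 then prog_F Boot (view x (\<lambda>_. {})) (rd aux 0) (left_nb (\<lambda>_. {}) p) {} {} else {})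
     = enc (length x) (\<lambda>_. 0) blank"
    by (auto simp: enc_def prog_F_def left_nb_def fun_eq_iff)
  then show ?thesis
    by (simp add: sweep_round_def prog_hlt_def prog_G_def act_def list_update_rd mv_0)
qed

lemma round_Spread:
  assumes "ah \<le> length aux - 1"
  shows "sweep_round x (Spread, enc (length x) (\<lambda>_. 0) blank, aux, ah, out)
    = (First, enc (length x) spread blank, aux, ah, out)"
  using assms
  by (subst quiet_round[where v' = spread]) (auto simp: prog_hlt_def act_def spread_def)

lemma spread_le [simp]: "spread h \<le> Suc n" by (simp add: spread_def)

lemma round_First:
  assumes "ah \<le> length aux - 1"
  shows "sweep_round x (First, enc (length x) spread blank, aux, ah, out)
    = (if x = [] then (Halt, enc (length x) spread blank, aux, ah, out @ [ans x])
       else (FindEnd, enc (length x) (spread(4 := 2)) blank, aux, ah, out))"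
proof -
  have u: "symbol_at (view x (enc (length x) spread blank)) 3 = insym x 1"
    by (simp add: symbol_at_head spread_def)
  show ?thesis
  proof (cases "x = []")
    case True
    show ?thesis using True assms u
      by (subst quiet_round[where v' = spread and mvs = stay and q' = Halt and ob = "Some (ans [])"])
        (auto simp: prog_hlt_def act_def stay_def insym_def)
  next
    case False
    then have "insym x 1 \<noteq> None" by (auto simp: insym_def Suc_le_eq)
    then show ?thesis using False assms u
      by (subst quiet_round[where v' = "spread(4 := 2)" and mvs = "stay(4 := (4, 1))" and q' = FindEnd
            and ob = None])
        (auto simp: prog_hlt_def act_def stay_def spread_def)
  qed
qed

text \<open>Head \<open>4\<close> overshoots to the end-marker, where the end is noticed, and then
  steps back.\<close>

lemma reach_FindEnd:
  assumes ah: "ah \<le> length aux - 1" and n: "x \<noteq> []" and r: "2 \<le> r" "r \<le> length x + 1"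
  shows "reach x (length x + 2 - r) (FindEnd, enc (length x) (spread(4 := r)) blank, aux, ah, out)
     (LogTest, enc (length x) (spread(4 := length x)) blank, aux, ah, out)"
  using r
proof (induction "length x + 1 - r" arbitrary: r)
  case 0
  then have r: "r = length x + 1" by simp
  have "symbol_at (view x (enc (length x) (spread(4 := r)) blank)) 4 = None"
    using r by (subst symbol_at_head) (auto simp: insym_def)
  then have "sweep_round x (FindEnd, enc (length x) (spread(4 := r)) blank, aux, ah, out)
     = (LogTest, enc (length x) (spread(4 := length x)) blank, aux, ah, out)"
    using ah r
    by (subst quiet_round[where v' = "spread(4 := length x)" and mvs = "stay(4 := (4, -1))"
          and q' = LogTest and ob = None])
      (auto simp: prog_hlt_def act_def stay_def spread_def)
  from reach_round[OF this] show ?case using r by (simp del: fun_upd_apply)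
next
  case (Suc m)
  then have r: "r \<le> length x" by simp
  have "symbol_at (view x (enc (length x) (spread(4 := r)) blank)) 4 \<noteq> None"
    using r Suc.prems by (subst symbol_at_head) (auto simp: insym_def)
  then have "sweep_round x (FindEnd, enc (length x) (spread(4 := r)) blank, aux, ah, out)
     = (FindEnd, enc (length x) (spread(4 := Suc r)) blank, aux, ah, out)"
    using ah r
    by (subst quiet_round[where v' = "spread(4 := Suc r)" and mvs = "stay(4 := (4, 1))"
          and q' = FindEnd and ob = None])
      (auto simp: prog_hlt_def act_def stay_def spread_def)
  note reach_round[OF this]
  moreover have "reach x (length x + 2 - Suc r) (FindEnd, enc (length x) (spread(4 := Suc r)) blank, aux, ah, out)
     (LogTest, enc (length x) (spread(4 := length x)) blank, aux, ah, out)"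
    using Suc r by (intro Suc.hyps) auto
  ultimately show ?case by (rule reach_trans) (use r in simp)
qed

definition log_heads :: "nat \<Rightarrow> nat \<Rightarrow> nat \<Rightarrow> nat \<Rightarrow> nat \<Rightarrow> nat" where
  "log_heads n p t l = spread(4 := n, 5 := p, 6 := t, 7 := l)"

lemma log_heads_simps [simp]:
  "log_heads n p t l 2 = 0" "log_heads n p t l 3 = 1" "log_heads n p t l 4 = n"
  "log_heads n p t l 5 = p" "log_heads n p t l 6 = t" "log_heads n p t l 7 = l"
  by (simp_all add: log_heads_def spread_def)

lemma log_heads_le:
  "p \<le> n \<Longrightarrow> t \<le> n \<Longrightarrow> l \<le> n \<Longrightarrow> log_heads n p t l h \<le> n + 1"
  by (simp add: log_heads_def spread_def)

text \<open>Addition in unary. It saturates at \<open>n\<close>, because head \<open>5\<close> must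
  stay on the tape and only its reaching \<open>n\<close> matters.\<close>

lemma reach_LogAdd:
  assumes ah: "ah \<le> length aux - 1" and pl: "p \<le> length x" "t \<le> length x" "l \<le> length x"
  shows "reach x (t + 1)
     (LogAdd, enc (length x) (log_heads (length x) p t l) blank, aux, ah, out)
     (LogTest, enc (length x) (log_heads (length x) (min (p + t) (length x)) 0 l) blank, aux, ah, out)"
  using pl(1,2)
proof (induction t arbitrary: p)
  case 0
  let ?v = "log_heads (length x) p 0 l"
  have "meet (view x (enc (length x) ?v blank)) 6 2" by (subst meet_heads) auto
  then have "sweep_round x (LogAdd, enc (length x) ?v blank, aux, ah, out)
      = (LogTest, enc (length x) ?v blank, aux, ah, out)"
    using ah 0 pl
    by (subst quiet_round[where v' = ?v and mvs = stay and q' = LogTest and ob = None])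
      (auto simp: prog_hlt_def act_def stay_def log_heads_le[simplified])
  from reach_round[OF this] show ?case using 0 by (simp add: min_absorb1)
next
  case (Suc t)
  let ?n = "length x"
  let ?v = "log_heads ?n p (Suc t) l" and ?p' = "if p = ?n then p else p + 1"
  let ?v' = "log_heads ?n ?p' t l"
  have "\<not> meet (view x (enc ?n ?v blank)) 6 2" using Suc.prems by (subst meet_heads) auto
  moreover have "meet (view x (enc ?n ?v blank)) 5 4 \<longleftrightarrow> p = ?n" using Suc.prems by (subst meet_heads) auto
  ultimately have "act LogAdd (view x (enc ?n ?v blank)) (rd aux ah)
     = (LogAdd, stay(6 := (6, -1), 5 := (5, if p = ?n then 0 else 1)), None, rd aux ah, 0, None)"
    by (simp add: act_def)
  then have "sweep_round x (LogAdd, enc ?n ?v blank, aux, ah, out)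
      = (LogAdd, enc ?n ?v' blank, aux, ah, out)"
    using ah Suc.prems pl
    by (subst quiet_round[where v' = ?v' and q' = LogAdd and ob = None
          and mvs = "stay(6 := (6, -1), 5 := (5, if p = ?n then 0 else 1))"])
      (auto simp: prog_hlt_def stay_def log_heads_le[simplified] log_heads_def)
  note 1 = reach_round[OF this]
  have "reach x (t + 1) (LogAdd, enc ?n ?v' blank, aux, ah, out)
     (LogTest, enc ?n (log_heads ?n (min (?p' + t) ?n) 0 l) blank, aux, ah, out)"
    using Suc.prems by (intro Suc.IH) auto
  moreover have "min (?p' + t) ?n = min (p + Suc t) ?n" using Suc.prems by auto
  ultimately have "reach x (t + 1) (LogAdd, enc ?n ?v' blank, aux, ah, out)
     (LogTest, enc ?n (log_heads ?n (min (p + Suc t) ?n) 0 l) blank, aux, ah, out)"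
    by (simp only:)
  from reach_trans[OF 1 this] show ?case by simp
qed

text \<open>Head \<open>5\<close> stands at \<open>min (2 ^ i) n\<close>, which by
  \<open>log_ceiling_bounds\<close> equals \<open>n\<close> for the first time at
  \<open>i = L\<close>. The position \<open>t\<close> of head \<open>6\<close> is arbitrary since it
  is overwritten before use: it is \<open>1\<close> at first and \<open>0\<close> after each
  addition.\<close>

lemma reach_LogTest:
  assumes ah: "ah \<le> length aux - 1" and n: "2 \<le> length x" and L: "L = nat \<lceil>log 2 (real (length x))\<rceil>"
    and i: "i \<le> L" "t \<le> length x"
  shows "reach x ((L - i) * (length x + 2) + 1)
     (LogTest, enc (length x) (log_heads (length x) (min (2 ^ i) (length x)) t i) blank, aux, ah, out)
     (Sim 0 0, enc (length x) (log_heads (length x) (length x) (if i = L then t else 0) L) blank, aux, ah, out)"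
  using i
proof (induction "L - i" arbitrary: i t)
  case 0
  let ?n = "length x"
  note Lb = log_ceiling_bounds[OF n L]
  have i: "i = L" "min (2 ^ i) ?n = ?n" using 0 Lb(1) by auto
  let ?v = "log_heads ?n ?n t L"
  have "\<not> meet (view x (enc ?n ?v blank)) 4 3" "meet (view x (enc ?n ?v blank)) 5 4"
    using n by (subst meet_heads; auto)+
  then have "sweep_round x (LogTest, enc ?n ?v blank, aux, ah, out) = (Sim 0 0, enc ?n ?v blank, aux, ah, out)"
    using ah 0 Lb(4)
    by (subst quiet_round[where v' = ?v and mvs = stay and q' = "Sim 0 0" and ob = None])
      (auto simp: prog_hlt_def act_def stay_def log_heads_le[simplified])
  from reach_round[OF this] show ?case using i by simp
next
  case (Suc m)
  let ?n = "length x"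
  note Lb = log_ceiling_bounds[OF n L]
  have i: "i < L" "2 ^ i < ?n" using Suc Lb(2) by auto
  let ?v = "log_heads ?n (2 ^ i) t i" and ?v' = "log_heads ?n (2 ^ i) (2 ^ i) (i + 1)"
  have "\<not> meet (view x (enc ?n ?v blank)) 4 3" "\<not> meet (view x (enc ?n ?v blank)) 5 4"
    using n i by (subst meet_heads; auto)+
  then have "sweep_round x (LogTest, enc ?n ?v blank, aux, ah, out) = (LogAdd, enc ?n ?v' blank, aux, ah, out)"
    using ah Suc.prems Lb(4) i
    by (subst quiet_round[where v' = ?v' and mvs = "stay(7 := (7, 1), 6 := (5, 0))" and q' = LogAdd
          and ob = None])
      (auto simp: prog_hlt_def act_def stay_def log_heads_le[simplified] log_heads_def)
  note reach_round[OF this]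
  moreover have "reach x (2 ^ i + 1) (LogAdd, enc ?n ?v' blank, aux, ah, out)
     (LogTest, enc ?n (log_heads ?n (min (2 ^ i + 2 ^ i) ?n) 0 (i + 1)) blank, aux, ah, out)"
    using i Lb(4) by (intro reach_LogAdd ah) auto
  ultimately have "reach x (?n + 2) (LogTest, enc ?n ?v blank, aux, ah, out)
     (LogTest, enc ?n (log_heads ?n (min (2 ^ i + 2 ^ i) ?n) 0 (i + 1)) blank, aux, ah, out)"
    by (rule reach_trans) (use i(2) in simp)
  then have 1: "reach x (?n + 2) (LogTest, enc ?n ?v blank, aux, ah, out)
     (LogTest, enc ?n (log_heads ?n (min (2 ^ (i + 1)) ?n) 0 (i + 1)) blank, aux, ah, out)"
    by (simp only: power_add power_one_right mult_2_right)
  have 2: "reach x ((L - (i + 1)) * (?n + 2) + 1)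
     (LogTest, enc ?n (log_heads ?n (min (2 ^ (i + 1)) ?n) 0 (i + 1)) blank, aux, ah, out)
     (Sim 0 0, enc ?n (log_heads ?n ?n (if i + 1 = L then 0 else 0) L) blank, aux, ah, out)"
    using Suc i by (intro Suc.hyps) auto
  have "L - i = L - (i + 1) + 1" using i by simp
  then have "?n + 2 + ((L - (i + 1)) * (?n + 2) + 1) \<le> (L - i) * (?n + 2) + 1" by simp
  from reach_trans[OF 1 2 this] show ?case using i by simp
qed

text \<open>For \<open>n < 2\<close> a base-\<open>n\<close> digit cannot count, and
  \<open>logbits\<close> replaces \<open>n\<close> by \<open>2\<close>. Only three inputs are that
  short, so their answers are built into the program.\<close>

lemma reach_answer:
  assumes "length x < 2"
  shows "\<exists>c ah. reach x 6 (init_sweep aux) (Halt, c, aux, ah, [ans x])"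
proof -
  have 1: "reach x 1 (init_sweep aux) (Spread, enc (length x) (\<lambda>_. 0) blank, aux, 0, [])"
    unfolding init_sweep_def by (rule reach_round[OF round_Boot])
  have 2: "reach x 2 (init_sweep aux) (First, enc (length x) spread blank, aux, 0, [])"
    by (rule reach_trans[OF 1 reach_round[OF round_Spread]]) auto
  have 3: "reach x 3 (init_sweep aux) (if x = []
      then (Halt, enc (length x) spread blank, aux, 0, [ans x])
      else (FindEnd, enc (length x) (spread(4 := 2)) blank, aux, 0, []))"
    using reach_trans[OF 2 reach_round[OF round_First, of 0 aux x "[]"], of 3] by (simp only: append_Nil)
  show ?thesis
  proof (cases "x = []")
    case True
    then show ?thesis using reach_mono[OF 3, of 6] by auto
  next
    case False
    then obtain y where x: "x = [y]" using assms by (cases x; cases "tl x") auto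
    have 4: "reach x 4 (init_sweep aux) (LogTest, enc (length x) (spread(4 := length x)) blank, aux, 0, [])"
      using reach_trans[OF 3[unfolded if_not_P[OF False]] reach_FindEnd[OF _ False, of 0 aux 2 "[]"], of 4] x
      by simp
    let ?v = "spread(4 := length x)"
    have m: "meet (view x (enc (length x) ?v blank)) 4 3"
      using x by (subst meet_heads) (auto simp: spread_def)
    have "symbol_at (view x (enc (length x) ?v blank)) 3 = Some y"
      using x by (subst symbol_at_head) (auto simp: spread_def insym_def)
    then have "sweep_round x (LogTest, enc (length x) ?v blank, aux, 0, [])
       = (Halt, enc (length x) ?v blank, aux, 0, emit [] (Some (ans x)))"
      using m x by (intro quiet_round[where mvs = stay])
        (auto simp: prog_hlt_def act_def stay_def spread_def)
    from reach_trans[OF 4 reach_round[OF this], of 6] show ?thesis by auto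
  qed
qed

lemma reach_Sim:
  assumes n: "2 \<le> length x" and L: "L = nat \<lceil>log 2 (real (length x))\<rceil>"
  shows "reach x ((length x + 2) ^ 3) (init_sweep aux)
     (Sim 0 0, enc (length x) (log_heads (length x) (length x) 0 L) blank, aux, 0, [])"
proof -
  let ?n = "length x"
  note Lb = log_ceiling_bounds[OF n L]
  have ne: "x \<noteq> []" using n by auto
  have 1: "reach x 1 (init_sweep aux) (Spread, enc ?n (\<lambda>_. 0) blank, aux, 0, [])"
    unfolding init_sweep_def by (rule reach_round[OF round_Boot])
  have 2: "reach x 2 (init_sweep aux) (First, enc ?n spread blank, aux, 0, [])"
    by (rule reach_trans[OF 1 reach_round[OF round_Spread]]) auto
  have 3: "reach x 3 (init_sweep aux) (FindEnd, enc ?n (spread(4 := 2)) blank, aux, 0, [])"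
    using reach_trans[OF 2 reach_round[OF round_First, of 0 aux x "[]"], of 3] ne by simp
  have 4: "reach x (?n + 3) (init_sweep aux) (LogTest, enc ?n (spread(4 := ?n)) blank, aux, 0, [])"
    using reach_trans[OF 3 reach_FindEnd[OF _ ne, of 0 aux 2 "[]"], of "?n + 3"] n by simp
  have "spread(4 := ?n) = log_heads ?n (min (2 ^ 0) ?n) 1 0"
    using n by (auto simp: log_heads_def spread_def fun_eq_iff)
  with 4 have 4: "reach x (?n + 3) (init_sweep aux)
      (LogTest, enc ?n (log_heads ?n (min (2 ^ 0) ?n) 1 0) blank, aux, 0, [])" by simp
  have 5: "reach x ((L - 0) * (?n + 2) + 1)
     (LogTest, enc ?n (log_heads ?n (min (2 ^ 0) ?n) 1 0) blank, aux, 0, [])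
     (Sim 0 0, enc ?n (log_heads ?n ?n (if 0 = L then 1 else 0) L) blank, aux, 0, [])"
    using n by (intro reach_LogTest L) auto
  have "L * (?n + 2) \<le> ?n * (?n + 2)" using Lb(4) by (rule mult_le_mono1)
  then have "?n + 3 + ((L - 0) * (?n + 2) + 1) \<le> (?n + 2) ^ 3"
    by (simp add: power3_eq_cube algebra_simps)
  from reach_trans[OF 4 5 this] show ?thesis using Lb(3) by simp
qed

end

section \<open>Simulation step by step\<close>

lemma mv_cases:
  "p < b \<Longrightarrow> mv p d (b - 1) = (if d > 0 then (if p + 1 = b then p else p + 1) else if d < 0 then p - 1 else p)"
  by (cases d "0 :: int" rule: linorder_cases) (auto simp: mv_def)

lemma block_index_eq:
  fixes k :: nat
  assumes "j < k" "j' < k" shows "p * k + j = p' * k + j' \<longleftrightarrow> p = p' \<and> j = j'"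
proof
  assume "p * k + j = p' * k + j'"
  then have "(p * k + j) div k = (p' * k + j') div k" "(p * k + j) mod k = (p' * k + j') mod k"
    by simp_all
  then show "p = p' \<and> j = j'" using assms by simp
qed simp

lemma block_index_less:
  fixes k :: nat
  assumes "j < k" "p < L" shows "p * k + j < L * k"
proof -
  have "p * k + j < (p + 1) * k" using assms by simp
  also have "\<dots> \<le> L * k" using assms by (intro mult_right_mono) auto
  finally show ?thesis .
qed

context simulation begin

text \<open>The catalytic tape is a prefix of the random tape, and the clock value equals the number
  \<open>t\<close> of simulated steps. The scratch heads \<open>5\<close> and \<open>6\<close> only
  have to stay on the tape.\<close>

definition simulates :: "bool list \<Rightarrow> nat \<Rightarrow> config \<Rightarrow> nat \<Rightarrow> (nat \<Rightarrow> nat) \<Rightarrow> (nat \<Rightarrow> nat \<Rightarrow> bool) \<Rightarrow>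
    bool list \<Rightarrow> bool" where
  "simulates x t cf j v D aux \<longleftrightarrow> (case cf of (s, i, w, wh, c, ch, out) \<Rightarrow>
     let n = length x; L = nat \<lceil>log 2 (real n)\<rceil> in
     v 2 = 0 \<and> v 3 = 1 \<and> v 4 = n \<and> v 5 \<le> n + 1 \<and> v 6 \<le> n + 1 \<and> v 7 = L \<and>
     v 8 = i \<and> i \<le> n + 1 \<and> 1 \<le> v 9 \<and> v 9 \<le> L \<and>
     (\<forall>h. 10 \<le> h \<and> h < 10 + k + a \<longrightarrow> 1 \<le> v h \<and> v h \<le> n) \<and>
     ch = odo n (\<lambda>i. v (10 + i)) k \<and> t = odo n (\<lambda>i. v (10 + k + i)) a \<and>
     length w = k * L \<and> (if k = 0 then j = 0 \<and> wh = 0 else j < k \<and> wh = (v 9 - 1) * k + j) \<and>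
     (\<forall>p j. 1 \<le> p \<and> p \<le> L \<and> j < k \<longrightarrow> w ! ((p - 1) * k + j) = D p j) \<and>
     length c = n ^ k \<and> n ^ k \<le> length aux \<and> take (n ^ k) aux = c)"

lemma inc_move_digit:
  fixes x v D
  defines "ob \<equiv> view x (enc (length x) v D)"
  assumes v: "\<And>h. h \<in> heads \<Longrightarrow> v h \<le> length x + 1" "v 3 = 1" "v 4 = length x"
    and s: "\<And>m. m \<le> i \<Longrightarrow> s + m \<in> heads"
  shows "fst (inc_move ob s i) \<in> heads" "snd (inc_move ob s i) \<in> {-1, 0, 1}"
    "int (v (fst (inc_move ob s i))) + snd (inc_move ob s i)
      = int (if \<forall>m<i. v (s + m) = length x
             then (if v (s + i) = length x then 1 else v (s + i) + 1) else v (s + i))"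
proof -
  have "meet ob (s + m) 4 \<longleftrightarrow> v (s + m) = length x" if "m \<le> i" for m
    unfolding ob_def using v s[OF that] by (simp add: meet_heads)
  then show "fst (inc_move ob s i) \<in> heads" "snd (inc_move ob s i) \<in> {-1, 0, 1}"
    "int (v (fst (inc_move ob s i))) + snd (inc_move ob s i)
      = int (if \<forall>m<i. v (s + m) = length x
             then (if v (s + i) = length x then 1 else v (s + i) + 1) else v (s + i))"
    using s[of i] v by (auto simp: inc_move_def)
qed

lemma dec_move_digit:
  fixes x v D
  defines "ob \<equiv> view x (enc (length x) v D)"
  assumes v: "\<And>h. h \<in> heads \<Longrightarrow> v h \<le> length x + 1" "v 3 = 1" "v 4 = length x"
    and s: "\<And>m. m \<le> i \<Longrightarrow> s + m \<in> heads" and pos: "1 \<le> v (s + i)"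
  shows "fst (dec_move ob s i) \<in> heads" "snd (dec_move ob s i) \<in> {-1, 0, 1}"
    "int (v (fst (dec_move ob s i))) + snd (dec_move ob s i)
      = int (if \<forall>m<i. v (s + m) = 1
             then (if v (s + i) = 1 then length x else v (s + i) - 1) else v (s + i))"
proof -
  have "meet ob (s + m) 3 \<longleftrightarrow> v (s + m) = 1" if "m \<le> i" for m
    unfolding ob_def using v s[OF that] by (simp add: meet_heads)
  then show "fst (dec_move ob s i) \<in> heads" "snd (dec_move ob s i) \<in> {-1, 0, 1}"
    "int (v (fst (dec_move ob s i))) + snd (dec_move ob s i)
      = int (if \<forall>m<i. v (s + m) = 1
             then (if v (s + i) = 1 then length x else v (s + i) - 1) else v (s + i))"
    using s[of i] v pos by (auto simp: dec_move_def of_nat_diff)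
qed

text \<open>The bound on \<open>t\<close> keeps the clock from stopping the round. Each head is
  clamped by comparing marks, and \<open>mv_cases\<close> shows that this agrees with the clamping
  in \<open>step\<close>.\<close>

lemma simulates_step:
  assumes n: "2 \<le> length x" and rel: "simulates x t (s, i, w, wh, c, ch, out) j v D aux"
    and nh: "\<not> halting M s" and t: "t + 1 < length x ^ a"
  shows "\<exists>s' i' w' wh' c' ch' out' j' v' D' aux'.
     step M x (s, i, w, wh, c, ch, out) = (s', i', w', wh', c', ch', out') \<and>
     sweep_round x (Sim s j, enc (length x) v D, aux, ch, out)
       = (Sim s' j', enc (length x) v' D', aux', ch', out') \<and>
     simulates x (t + 1) (s', i', w', wh', c', ch', out') j' v' D' aux'"
proof -
  define N where "N = length x"
  define L where "L = nat \<lceil>log 2 (real N)\<rceil>"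
  note Lb = log_ceiling_bounds[OF n[folded N_def] L_def]
  define ob where "ob = view x (enc N v D)"
  have v: "v 2 = 0" "v 3 = 1" "v 4 = N" "v 5 \<le> N + 1" "v 6 \<le> N + 1" "v 7 = L"
     "v 8 = i" "i \<le> N + 1" "1 \<le> v 9" "v 9 \<le> L"
    and dig: "\<And>h. 10 \<le> h \<Longrightarrow> h < 10 + k + a \<Longrightarrow> 1 \<le> v h \<and> v h \<le> N"
    and ch: "ch = odo N (\<lambda>i. v (10 + i)) k" and tt: "t = odo N (\<lambda>i. v (10 + k + i)) a"
    and w: "length w = k * L" "if k = 0 then j = 0 \<and> wh = 0 else j < k \<and> wh = (v 9 - 1) * k + j"
    and wD: "\<And>p j. 1 \<le> p \<Longrightarrow> p \<le> L \<Longrightarrow> j < k \<Longrightarrow> w ! ((p - 1) * k + j) = D p j"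
    and c: "length c = N ^ k" "N ^ k \<le> length aux" "take (N ^ k) aux = c"
    using rel unfolding simulates_def Let_def prod.case N_def[symmetric] L_def[symmetric] by blast+
  have N0: "N > 0" "N > 1" using n by (auto simp: N_def)
  have vle: "v h \<le> N + 1" if "h \<in> heads" for h
  proof -
    have "h \<in> {2, 3, 4, 5, 6, 7, 8, 9} \<or> 10 \<le> h \<and> h < 10 + k + a" using that by (auto simp: heads_def)
    then show ?thesis using v dig[of h] Lb(4) by auto
  qed
  have meet: "meet ob g h \<longleftrightarrow> v g = v h" if "g \<in> heads" "h \<in> heads" for g h
    unfolding ob_def N_def using that vle[of g] by (simp add: meet_heads N_def)
  have cat: "10 + m \<in> heads" if "m < k" for m using that by (simp add: heads_def)
  have clk: "10 + k + m \<in> heads" if "m < a" for m using that by (simp add: heads_def)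
  \<comment> \<open>The two ends of the catalytic tape show up as digits that are all largest or all
    smallest.\<close>
  have allmax: "(\<forall>m<k. meet ob (10 + m) 4) \<longleftrightarrow> ch + 1 = N ^ k"
    unfolding ch using meet cat v dig N0 by (subst odo_max_iff[symmetric]) auto
  have allmin: "(\<forall>m<k. meet ob (10 + m) 3) \<longleftrightarrow> ch = 0"
    unfolding ch using meet cat v dig N0 by (subst odo_min_iff[symmetric, of N]) auto
  have clkmax: "\<not> (\<forall>m<a. meet ob (10 + k + m) 4)"
  proof -
    have "(\<forall>m<a. meet ob (10 + k + m) 4) \<longleftrightarrow> t + 1 = N ^ a"
      unfolding tt using meet clk v dig N0 by (subst odo_max_iff[symmetric]) auto
    then show ?thesis using t by (simp add: N_def)
  qed
  have chN: "ch < N ^ k" unfolding ch using dig N0 by (intro odo_less) auto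
  have chaux: "ch < length aux" using chN c by simp
  have rdaux: "rd aux ch = rd c ch" using chN chaux c by (auto simp: rd_def)
  have rdw: "(j < k \<and> meet ob 9 (dat j)) = rd w wh"
  proof (cases "k = 0")
    case True
    then show ?thesis using w by (simp add: rd_def)
  next
    case False
    then have jw: "j < k" "wh = (v 9 - 1) * k + j" using w(2) by auto
    then have "wh < length w" using block_index_less[of j k "v 9 - 1" L] v w(1) by (simp add: mult.commute)
    moreover have "meet ob 9 (dat j) = D (v 9) j"
      unfolding ob_def N_def using jw vle[of 9] by (simp add: meet_dat N_def)
    ultimately show ?thesis using jw wD[of "v 9" j] v by (simp add: rd_def)
  qed
  have und: "symbol_at ob 8 = insym x i"
    unfolding ob_def N_def using v vle[of 8] by (simp add: symbol_at_head N_def)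
  obtain s' di ww dw cw dc o' where
    d: "delta M s (insym x i) (rd w wh) (rd c ch) = (s', di, ww, dw, cw, dc, o')"
    by (metis prod_cases7)
  define j' where "j' = fst (work_move ob j dw)"
  define dp where "dp = snd (work_move ob j dw)"
  define am where "am = (if dc > 0 \<and> (\<forall>m<k. meet ob (10 + m) 4) then 0 else dc)"
  define mvs where "mvs = sim_move ob di dp dc"
  have act: "act (Sim s j) ob (rd aux ch) = (Sim s' j', mvs, Some (j, ww), cw, am, o')"
    using clkmax d by (simp add: act_def und rdw rdaux j'_def dp_def am_def mvs_def)
  define v' where "v' h = nat (int (v (fst (mvs h))) + snd (mvs h))" for h
  define D' where "D' p m = (if m = j \<and> p = v 9 then ww else D p m)" for p m
  define i' where "i' = mv i di (N + 1)"
  define wh' where "wh' = mv wh dw (length w - 1)"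
  define ch' where "ch' = mv ch dc (length c - 1)"
  have st: "step M x (s, i, w, wh, c, ch, out) = (s', i', w[wh := ww], wh', c[ch := cw], ch', emit out o')"
    using nh d by (simp add: step_def i'_def wh'_def ch'_def emit_def N_def)

  have inp: "input_dir ob di \<in> {-1, 0, 1} \<and> int i + input_dir ob di = int i'"
  proof -
    have "insym x i = None \<and> i \<noteq> 0 \<longleftrightarrow> i = N + 1" using v by (auto simp: insym_def N_def)
    moreover have "meet ob 8 2 \<longleftrightarrow> i = 0" using meet v by simp
    ultimately show ?thesis unfolding i'_def using mv_cases[of i "N + 2" di] v(8)
      by (auto simp: input_dir_def und)
  qed
  have i': "i' \<le> N + 1" unfolding i'_def by (rule mv_le)
  have m97: "meet ob 9 7 \<longleftrightarrow> v 9 = L" "meet ob 9 3 \<longleftrightarrow> v 9 = 1" using meet v by auto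
  have dp: "dp \<in> {-1, 0, 1}" "1 \<le> int (v 9) + dp" "int (v 9) + dp \<le> int L"
    using v(9,10) by (auto simp: dp_def work_move_def m97)
  define p' where "p' = nat (int (v 9) + dp)"
  have wk: "if k = 0 then j' = 0 \<and> wh' = 0 else j' < k \<and> wh' = (p' - 1) * k + j'"
  proof (cases "k = 0")
    case True
    have "j' = 0" unfolding j'_def work_move_def using True w(2) by auto
    \<comment> \<open>The work tape is empty, and \<open>0 - 1 = 0\<close> keeps its head at
      \<open>0\<close>.\<close>
    moreover have "wh' = 0" unfolding wh'_def using True w by (simp add: mv_def)
    ultimately show ?thesis using True by simp
  next
    case False
    then have jw: "j < k" "wh = (v 9 - 1) * k + j" using w(2) by auto
    define p where "p = v 9 - 1"
    have p: "v 9 = p + 1" "wh = p * k + j" "p < L" using v(9,10) jw by (auto simp: p_def)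
    have whL: "wh < L * k" unfolding p(2) using jw p by (intro block_index_less) auto
    have wh': "wh' = (if dw > 0 then (if wh + 1 = L * k then wh else wh + 1)
        else if dw < 0 then wh - 1 else wh)"
      unfolding wh'_def w(1) using mv_cases[OF whL, of dw] by (simp add: mult.commute)
    \<comment> \<open>Inside a block there is always a next bit, so the right end is met only at the
      last bit of block \<open>L\<close>.\<close>
    have last: "wh + 1 = L * k \<longleftrightarrow> p + 1 = L \<and> j + 1 = k"
    proof
      assume eq: "wh + 1 = L * k"
      have "\<not> j + 1 < k" using block_index_less[of "j + 1" k p L] p eq by auto
      then have j: "j + 1 = k" using jw by simp
      then have "(p + 1) * k = L * k" using eq p by (simp add: algebra_simps)
      then have "p + 1 = L" by (simp only: mult_right_cancel[OF False])
      then show "p + 1 = L \<and> j + 1 = k" using j by simp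
    next
      assume "p + 1 = L \<and> j + 1 = k"
      then have "L * k = p * k + (j + 1)" by auto
      then show "wh + 1 = L * k" using p by simp
    qed
    consider "dw = 0" | "dw > 0" "j + 1 < k" | "dw > 0" "j + 1 = k" "p + 1 = L"
      | "dw > 0" "j + 1 = k" "p + 1 \<noteq> L" | "dw < 0" "j > 0" | "dw < 0" "j = 0" "p = 0"
      | "dw < 0" "j = 0" "p > 0" using jw by linarith
    then show ?thesis
    proof cases
      case 4
      have "p * k + (j + 1) = (p + 1) * k" using 4 by simp
      then show ?thesis using 4 False wh' last p m97
        by (simp add: j'_def p'_def dp_def work_move_def nat_add_distrib)
    next
      case 7
      have "p * k = (p - 1) * k + k" using 7 by (cases p) auto
      then show ?thesis using 7 False wh' p m97
        by (simp add: j'_def p'_def dp_def work_move_def)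
    qed (use False jw wh' last p m97 in \<open>auto simp: j'_def p'_def dp_def work_move_def nat_add_distrib\<close>)
  qed
  have catm: "fst (cat_move ob dc m) \<in> heads \<and> snd (cat_move ob dc m) \<in> {-1, 0, 1}" and
    cat_int: "int (v (fst (cat_move ob dc m))) + snd (cat_move ob dc m) = int (
      if dc > 0 \<and> ch + 1 \<noteq> N ^ k then (if \<forall>l<m. v (10 + l) = N
             then (if v (10 + m) = N then 1 else v (10 + m) + 1) else v (10 + m))
      else if dc < 0 \<and> ch \<noteq> 0 then (if \<forall>l<m. v (10 + l) = 1
             then (if v (10 + m) = 1 then N else v (10 + m) - 1) else v (10 + m))
      else v (10 + m))" if m: "m < k" for m
  proof -
    have hd: "\<And>l. l \<le> m \<Longrightarrow> 10 + l \<in> heads" using m cat by simp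
    have pos: "1 \<le> v (10 + m)" using dig[of "10 + m"] m by simp
    note I = inc_move_digit[of v x m 10 D, OF vle[unfolded N_def] v(2) v(3)[unfolded N_def] hd, folded N_def, folded ob_def]
    note J = dec_move_digit[of v x m 10 D, OF vle[unfolded N_def] v(2) v(3)[unfolded N_def] hd pos, folded N_def, folded ob_def]
    show "fst (cat_move ob dc m) \<in> heads \<and> snd (cat_move ob dc m) \<in> {-1, 0, 1}"
      using I(1,2) J(1,2) cat[OF m] unfolding cat_move_def by auto
    show "int (v (fst (cat_move ob dc m))) + snd (cat_move ob dc m) = int (
      if dc > 0 \<and> ch + 1 \<noteq> N ^ k then (if \<forall>l<m. v (10 + l) = N
             then (if v (10 + m) = N then 1 else v (10 + m) + 1) else v (10 + m))
      else if dc < 0 \<and> ch \<noteq> 0 then (if \<forall>l<m. v (10 + l) = 1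
             then (if v (10 + m) = 1 then N else v (10 + m) - 1) else v (10 + m))
      else v (10 + m))"
      unfolding cat_move_def allmax allmin using I(3) J(3) by simp
  qed
  have clkm: "fst (inc_move ob (10 + k) m) \<in> heads" "snd (inc_move ob (10 + k) m) \<in> {-1, 0, 1}"
    "int (v (fst (inc_move ob (10 + k) m))) + snd (inc_move ob (10 + k) m) = int (
      if \<forall>l<m. v (10 + k + l) = N
             then (if v (10 + k + m) = N then 1 else v (10 + k + m) + 1) else v (10 + k + m))"
    if m: "m < a" for m
  proof -
    have hd: "\<And>l. l \<le> m \<Longrightarrow> 10 + k + l \<in> heads" using m clk by simp
    show "fst (inc_move ob (10 + k) m) \<in> heads" "snd (inc_move ob (10 + k) m) \<in> {-1, 0, 1}"
    "int (v (fst (inc_move ob (10 + k) m))) + snd (inc_move ob (10 + k) m) = int (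
      if \<forall>l<m. v (10 + k + l) = N
             then (if v (10 + k + m) = N then 1 else v (10 + k + m) + 1) else v (10 + k + m))"
      using inc_move_digit[of v x m "10 + k" D, OF vle[unfolded N_def] v(2) v(3)[unfolded N_def] hd,
          folded N_def, folded ob_def] by blast+
  qed
  have head_cases: "h \<in> {2, 3, 4, 5, 6, 7} \<or> h = 8 \<or> h = 9 \<or> (\<exists>m<k. h = 10 + m) \<or> (\<exists>m<a. h = 10 + k + m)"
    if "h \<in> heads" for h
  proof -
    have "h \<in> {2, 3, 4, 5, 6, 7, 8, 9} \<or> (10 \<le> h \<and> h < 10 + k) \<or> (10 + k \<le> h \<and> h < 10 + k + a)"
      using that by (auto simp: heads_def)
    moreover have "\<exists>m<k. h = 10 + m" if "10 \<le> h \<and> h < 10 + k"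
      using that by (intro exI[of _ "h - 10"]) auto
    moreover have "\<exists>m<a. h = 10 + k + m" if "10 + k \<le> h \<and> h < 10 + k + a"
      using that by (intro exI[of _ "h - (10 + k)"]) auto
    ultimately show ?thesis by blast
  qed
  have mvs_simps: "h \<in> {2, 3, 4, 5, 6, 7} \<Longrightarrow> mvs h = (h, 0)" "mvs 8 = (8, input_dir ob di)" "mvs 9 = (9, dp)"
    "m < k \<Longrightarrow> mvs (10 + m) = cat_move ob dc m" "mvs (10 + k + m) = inc_move ob (10 + k) m" for h m
    by (auto simp: mvs_def sim_move_def)
  have mvs: "fst (mvs h) \<in> heads \<and> snd (mvs h) \<in> {-1, 0, 1} \<and>
      int (v' h) = int (v (fst (mvs h))) + snd (mvs h)" if "h \<in> heads" for h
  proof -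
    have "fst (mvs h) \<in> heads \<and> snd (mvs h) \<in> {-1, 0, 1} \<and> 0 \<le> int (v (fst (mvs h))) + snd (mvs h)"
      using head_cases[OF that]
    proof (elim disjE exE conjE)
      assume "h \<in> {2, 3, 4, 5, 6, 7}"
      then show ?thesis using that by (simp add: mvs_simps(1))
    next
      assume "h = 8"
      then show ?thesis using inp v(7) by (simp add: mvs_simps(2))
    next
      assume "h = 9"
      then show ?thesis using dp by (simp add: mvs_simps(3))
    next
      fix m assume "m < k" "h = 10 + m"
      then show ?thesis using catm[of m] cat_int[of m] by (simp add: mvs_simps(4))
    next
      fix m assume "m < a" "h = 10 + k + m"
      then show ?thesis using clkm[of m] by (simp add: mvs_simps(5))
    qed
    then show ?thesis by (simp add: v'_def)
  qed
  have v'_fixed: "v' h = v h" if "h \<in> {2, 3, 4, 5, 6, 7}" for h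
    using that by (simp add: v'_def mvs_simps(1))
  have v'8: "v' 8 = i'" using inp v(7) by (simp add: v'_def mvs_simps(2))
  have v'9: "v' 9 = p'" by (simp add: v'_def mvs_simps(3) p'_def)
  have v'cat: "v' (10 + m) = (
      if dc > 0 \<and> ch + 1 \<noteq> N ^ k then (if \<forall>l<m. v (10 + l) = N
             then (if v (10 + m) = N then 1 else v (10 + m) + 1) else v (10 + m))
      else if dc < 0 \<and> ch \<noteq> 0 then (if \<forall>l<m. v (10 + l) = 1
             then (if v (10 + m) = 1 then N else v (10 + m) - 1) else v (10 + m))
      else v (10 + m))" if "m < k" for m
    unfolding v'_def mvs_simps(4)[OF that] cat_int[OF that] nat_int ..
  have v'clk: "v' (10 + k + m) = (if \<forall>l<m. v (10 + k + l) = N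
             then (if v (10 + k + m) = N then 1 else v (10 + k + m) + 1) else v (10 + k + m))"
    if "m < a" for m
    unfolding v'_def mvs_simps(5) clkm(3)[OF that] nat_int ..
  have dig': "1 \<le> v' h \<and> v' h \<le> N" if h: "10 \<le> h" "h < 10 + k + a" for h
  proof -
    have vh: "1 \<le> v h \<and> v h \<le> N" using dig h by simp
    have "h \<in> heads" using h by (simp add: heads_def)
    from head_cases[OF this] h consider m where "m < k" "h = 10 + m" | m where "m < a" "h = 10 + k + m"
      by auto
    then show ?thesis
    proof cases
      case 1
      then show ?thesis using v'cat[of m] vh N0 by auto
    next
      case 2
      then show ?thesis using v'clk[of m] vh N0 by auto
    qed
  qed
  have ch'_eq: "ch' = (if dc > 0 then (if ch + 1 = N ^ k then ch else ch + 1)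
      else if dc < 0 then ch - 1 else ch)"
    unfolding ch'_def c(1) by (rule mv_cases[OF chN])
  have ch'_odo: "ch' = odo N (\<lambda>i. v' (10 + i)) k"
  proof -
    \<comment> \<open>The first two cases exclude the overflow terms of \<open>odo_inc\<close> and
      \<open>odo_dec\<close>. In the third the head is blocked or at rest, and the digits
      stay.\<close>
    consider "dc > 0" "ch + 1 \<noteq> N ^ k" | "dc < 0" "ch \<noteq> 0" | "dc > 0 \<longrightarrow> ch + 1 = N ^ k" "dc < 0 \<longrightarrow> ch = 0"
      using less_asym[of dc 0] by blast
    then show ?thesis
    proof cases
      case 1
      have "odo N (\<lambda>i. v' (10 + i)) k + (if \<forall>i<k. v (10 + i) = N then N ^ k else 0)
          = odo N (\<lambda>i. v (10 + i)) k + 1"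
        using 1 v'cat dig by (intro odo_inc[OF N0(1)]) auto
      moreover have "\<not> (\<forall>i<k. v (10 + i) = N)" using 1(2) allmax meet cat v(3) by auto
      ultimately show ?thesis using 1 by (simp add: ch'_eq ch)
    next
      case 2
      have "odo N (\<lambda>i. v' (10 + i)) k + 1
          = odo N (\<lambda>i. v (10 + i)) k + (if \<forall>i<k. v (10 + i) = 1 then N ^ k else 0)"
        using 2 v'cat dig by (intro odo_dec[OF N0(1)]) auto
      moreover have "\<not> (\<forall>i<k. v (10 + i) = 1)" using 2(2) allmin meet cat v(2) by auto
      ultimately have "odo N (\<lambda>i. v' (10 + i)) k + 1 = ch" unfolding ch by (simp only: if_False add_0_right)
      then show ?thesis using 2 by (simp add: ch'_eq)
    next
      case 3
      then have "odo N (\<lambda>i. v' (10 + i)) k = odo N (\<lambda>i. v (10 + i)) k"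
        using v'cat by (auto simp: odo_def intro!: sum.cong)
      then show ?thesis using 3 ch by (auto simp: ch'_eq)
    qed
  qed
  have t_odo: "t + 1 = odo N (\<lambda>i. v' (10 + k + i)) a"
  proof -
    have "odo N (\<lambda>i. v' (10 + k + i)) a + (if \<forall>i<a. v (10 + k + i) = N then N ^ a else 0)
          = odo N (\<lambda>i. v (10 + k + i)) a + 1"
      using v'clk dig by (intro odo_inc[OF N0(1)]) auto
    moreover have "\<not> (\<forall>i<a. v (10 + k + i) = N)" using clkmax meet clk v(3) by auto
    ultimately show ?thesis using tt by simp
  qed
  \<comment> \<open>\<open>aux\<close> may be longer than \<open>c\<close>: the right end of
    \<open>c\<close> is enforced by \<open>am\<close>, while the left end is common to both
    tapes.\<close>
  have am: "mv ch am (length aux - 1) = ch'"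
    unfolding mv_cases[OF chaux] ch'_eq am_def allmax using c(2) chN by auto
  have w'D: "w[wh := ww] ! ((p - 1) * k + m) = D' p m" if "1 \<le> p" "p \<le> L" "m < k" for p m
  proof -
    have jw: "j < k" "wh = (v 9 - 1) * k + j" using w(2) that(3) by (auto split: if_splits)
    have lt: "wh < length w" using block_index_less[of j k "v 9 - 1" L] v jw w(1) by (simp add: mult.commute)
    have "(p - 1) * k + m = wh \<longleftrightarrow> p = v 9 \<and> m = j"
      unfolding jw(2) block_index_eq[OF that(3) jw(1)] using that(1) v(9) by auto
    then show ?thesis using lt wD[OF that] by (auto simp: D'_def nth_list_update)
  qed
  have sim': "simulates x (t + 1) (s', i', w[wh := ww], wh', c[ch := cw], ch', emit out o') j' v' D' (aux[ch := cw])"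
    unfolding simulates_def Let_def prod.case N_def[symmetric] L_def[symmetric]
    using v v'_fixed v'8 v'9 i' dp dig' ch'_odo t_odo w(1) wk w'D c
    by (intro conjI) (auto simp: p'_def take_update_swap)
  have "sweep_round x (Sim s j, enc N v D, aux, ch, out)
    = (Sim s' j', enc N v' D', aux[ch := cw], mv ch am (length aux - 1), emit out o')"
    unfolding N_def
  proof (rule sweep_round_enc[where mvs = mvs and wr = "Some (j, ww)"])
    show "act (Sim s j) (view x (enc (length x) v D)) (rd aux ch) = (Sim s' j', mvs, Some (j, ww), cw, am, o')"
      using act by (simp add: ob_def N_def)
  qed (use vle nh mvs in \<open>auto simp: N_def prog_hlt_def D'_def\<close>)
  then show ?thesis using st sim' unfolding am N_def by blast
qed

lemma simulates_init:
  assumes n: "2 \<le> length x" and L: "L = nat \<lceil>log 2 (real (length x))\<rceil>" and r: "length x ^ k \<le> length r"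
  shows "simulates x 0 (init_config (k * L) (take (length x ^ k) r)) 0
     (log_heads (length x) (length x) 0 L) blank r"
proof -
  note Lb = log_ceiling_bounds[OF n L]
  have one: "log_heads (length x) (length x) 0 L h = 1" if "9 \<le> h" for h
    using that by (auto simp: log_heads_def spread_def)
  have "log_heads (length x) (length x) 0 L 8 = 0" by (simp add: log_heads_def spread_def)
  moreover have "replicate (k * L) False ! ((p - 1) * k + j) = False" if "1 \<le> p" "p \<le> L" "j < k" for p j
    using block_index_less[of j k "p - 1" L] that by (simp add: mult.commute)
  ultimately show ?thesis using one Lb(3) n r
    unfolding simulates_def init_config_def Let_def prod.case L[symmetric]
    by (auto simp: odo_def)
qed

lemma simulates_run:
  assumes n: "2 \<le> length x" and L: "L = nat \<lceil>log 2 (real (length x))\<rceil>" and r: "length x ^ k \<le> length r"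
    and nh: "\<And>u. u < t \<Longrightarrow> \<not> halting M (cstate (run M x (k * L) (take (length x ^ k) r) u))"
    and t: "t < length x ^ a"
  shows "\<exists>s i w wh c ch out j v D aux.
     run M x (k * L) (take (length x ^ k) r) t = (s, i, w, wh, c, ch, out) \<and>
     (sweep_round x ^^ t) (Sim 0 0, enc (length x) (log_heads (length x) (length x) 0 L) blank, r, 0, [])
       = (Sim s j, enc (length x) v D, aux, ch, out) \<and>
     simulates x t (s, i, w, wh, c, ch, out) j v D aux"
  using nh t
proof (induction t)
  case 0
  show ?case using simulates_init[OF n L r] by (auto simp: init_config_def)
next
  case (Suc t)
  then obtain s i w wh c ch out j v D aux where IH:
     "run M x (k * L) (take (length x ^ k) r) t = (s, i, w, wh, c, ch, out)"
     "(sweep_round x ^^ t) (Sim 0 0, enc (length x) (log_heads (length x) (length x) 0 L) blank, r, 0, [])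
       = (Sim s j, enc (length x) v D, aux, ch, out)"
     "simulates x t (s, i, w, wh, c, ch, out) j v D aux"
    by (meson Suc_lessD less_SucI)
  have "\<not> halting M s" using Suc.prems(1)[of t] IH(1) by (simp add: cstate_def)
  from simulates_step[OF n IH(3) this] Suc.prems(2) show ?case
    unfolding run_Suc IH(1) funpow.simps o_apply IH(2) by (simp only: Suc_eq_plus1)
qed

lemma simulates_clock_max:
  assumes n: "2 \<le> length x" and sim: "simulates x t cf j v D aux" and t: "t + 1 = length x ^ a"
  shows "\<forall>m<a. meet (view x (enc (length x) v D)) (10 + k + m) 4"
proof -
  have v: "v 4 = length x" and dig: "\<And>h. 10 \<le> h \<Longrightarrow> h < 10 + k + a \<Longrightarrow> 1 \<le> v h \<and> v h \<le> length x"
    and tt: "t = odo (length x) (\<lambda>i. v (10 + k + i)) a"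
    using sim by (auto simp: simulates_def Let_def split: prod.splits)
  have "\<forall>m<a. v (10 + k + m) = length x"
    using n dig t tt by (subst odo_max_iff) auto
  then show ?thesis using v by (auto simp: meet_heads heads_def)
qed

text \<open>If \<open>M\<close> halts before step \<open>n ^ a\<close>, the simulating
  \<open>Sim\<close> state is itself halting. Otherwise the clock is at its maximum after
  \<open>n ^ a - 1\<close> rounds, and one more round enters \<open>Halt\<close>; nothing is claimed
  about the output then.\<close>

lemma simulation_outcome:
  assumes n: "2 \<le> length x" and L: "L = nat \<lceil>log 2 (real (length x))\<rceil>" and r: "length x ^ k \<le> length r"
  defines "\<tau> \<equiv> take (length x ^ k) r"
  shows "\<exists>q c aux ah out. reach x ((length x + 2) ^ 3 + length x ^ a) (init_sweep r) (q, c, aux, ah, out) \<and>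
     prog_hlt q \<and>
     (halts M x (k * L) \<tau> \<and> halt_time M x (k * L) \<tau> < length x ^ a \<longrightarrow>
        out = cout (final M x (k * L) \<tau>))"
proof -
  let ?n = "length x"
  let ?S = "(Sim 0 0, enc ?n (log_heads ?n ?n 0 L) blank, r, 0 :: nat, [] :: bool list)"
  let ?hlt = "\<lambda>t. halting M (cstate (run M x (k * L) \<tau> t))"
  note start = reach_Sim[OF n L, of r]
  note runs = simulates_run[OF n L r, folded \<tau>_def]
  show ?thesis
  proof (cases "\<exists>t<?n ^ a. ?hlt t")
    case True
    define t where "t = (LEAST t. ?hlt t)"
    have t: "?hlt t" "\<And>u. u < t \<Longrightarrow> \<not> ?hlt u"
      using True LeastI_ex[of ?hlt] not_less_Least[of _ ?hlt] by (auto simp: t_def)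
    have ta: "t < ?n ^ a" using True Least_le[of ?hlt] unfolding t_def by (meson le_less_trans)
    from runs[OF t(2) ta] obtain s i w wh c ch out j v D aux where
      R: "run M x (k * L) \<tau> t = (s, i, w, wh, c, ch, out)"
      "(sweep_round x ^^ t) ?S = (Sim s j, enc ?n v D, aux, ch, out)" by blast
    have "reach x t ?S (Sim s j, enc ?n v D, aux, ch, out)" unfolding reach_def using R(2) by blast
    from reach_trans[OF start this, of "(?n + 2) ^ 3 + ?n ^ a"]
    have "reach x ((?n + 2) ^ 3 + ?n ^ a) (init_sweep r) (Sim s j, enc ?n v D, aux, ch, out)"
      using ta by simp
    moreover have "prog_hlt (Sim s j)" using t(1) R(1) by (simp add: prog_hlt_def cstate_def)
    moreover have "out = cout (final M x (k * L) \<tau>)"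
      using final_eq_run[OF t(1)] R(1) by (simp add: cout_def)
    ultimately show ?thesis by blast
  next
    case False
    define t where "t = ?n ^ a - 1"
    have "0 < ?n ^ a" using n by (intro zero_less_power) linarith
    then have t: "t + 1 = ?n ^ a" by (simp add: t_def)
    have nh: "\<not> ?hlt u" if "u \<le> t" for u using False that t by auto
    have nl: "\<And>u. u < t \<Longrightarrow> \<not> ?hlt u" using nh by simp
    have "t < ?n ^ a" using t by simp
    from runs[OF nl this] obtain s i w wh c ch out j v D aux where
      R: "run M x (k * L) \<tau> t = (s, i, w, wh, c, ch, out)"
      "(sweep_round x ^^ t) ?S = (Sim s j, enc ?n v D, aux, ch, out)"
      "simulates x t (s, i, w, wh, c, ch, out) j v D aux" by blast
    have "\<not> halting M s" using nh[of t] R(1) by (simp add: cstate_def)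
    then have nhs: "\<not> prog_hlt (Sim s j)" by (simp add: prog_hlt_def)
    have act: "act (Sim s j) (view x (enc ?n v D)) (rd aux ch) = (Halt, stay, None, rd aux ch, 0, None)"
      using simulates_clock_max[OF n R(3) t] by (simp add: act_def)
    obtain c' aux' ah' out' where H:
      "sweep_round x (Sim s j, enc ?n v D, aux, ch, out) = (Halt, c', aux', ah', out')"
      using nhs act by (simp add: sweep_round_def prog_G_def)
    have "(sweep_round x ^^ (t + 1)) ?S = (Halt, c', aux', ah', out')"
      by (rule funpow_chain[OF R(2)]) (simp add: H)
    then have "reach x (t + 1) ?S (Halt, c', aux', ah', out')" unfolding reach_def by blast
    from reach_trans[OF start this, of "(?n + 2) ^ 3 + ?n ^ a"]
    have "reach x ((?n + 2) ^ 3 + ?n ^ a) (init_sweep r) (Halt, c', aux', ah', out')"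
      using t by simp
    moreover have "prog_hlt Halt" by (simp add: prog_hlt_def)
    moreover have "\<not> (halts M x (k * L) \<tau> \<and> halt_time M x (k * L) \<tau> < ?n ^ a)"
      using False halting_at_halt_time by blast
    ultimately show ?thesis by blast
  qed
qed

end

section \<open>Proportions, exponents and the conclusion\<close>

text \<open>The random string may be longer than a catalytic tape. Splitting it into prefix and rest
  shows that the excess bits leave the proportion of good strings unchanged.\<close>

lemma card_prefix:
  fixes S :: "bool list set"
  assumes "m \<le> T" "\<And>s. s \<in> S \<Longrightarrow> length s = m"
  shows "card {r. length r = T \<and> take m r \<in> S} = card S * 2 ^ (T - m)"
proof -
  let ?P = "S \<times> {w :: bool list. length w = T - m}"
  have "{r. length r = T \<and> take m r \<in> S} = (\<lambda>(u, w). u @ w) ` ?P"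
  proof (intro equalityI subsetI)
    fix r assume r: "r \<in> {r. length r = T \<and> take m r \<in> S}"
    then have "(take m r, drop m r) \<in> ?P" by simp
    then show "r \<in> (\<lambda>(u, w). u @ w) ` ?P"
      by (metis (mono_tags, lifting) append_take_drop_id case_prod_conv image_eqI)
  qed (use assms in auto)
  moreover have "inj_on (\<lambda>(u, w). u @ w) ?P" using assms(2) by (auto simp: inj_on_def)
  ultimately show ?thesis by (simp add: card_image card_cartesian_product card_bool_lists)
qed

text \<open>As \<open>n \<ge> 2\<close>, each polynomial factor is at most a power of
  \<open>n\<close>: the \<open>6\<close> costs exponent \<open>3\<close>, the states
  \<open>nstates M\<close>, the input head \<open>2\<close>, the work tape and its head
  \<open>2 * k\<close> each, the catalytic head \<open>k + 1\<close>, the Hamming ball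
  \<open>(k + 1) * D\<close>. The catalytic contents give \<open>2 ^ (n ^ k)\<close>, which cancels
  against the number of initial tapes.\<close>

lemma slow_run_bound:
  assumes n: "2 \<le> n" and L: "L = nat \<lceil>log 2 (real n)\<rceil>"
  shows "6 * card (core_space M n (k * L) (n ^ k)) * (n ^ k + 1) ^ D
     \<le> n ^ (nstates M + 5 * k + 6 + (k + 1) * D) * 2 ^ (n ^ k)"
proof -
  have base: "2 ^ i \<le> n ^ i" for i :: nat using n by (rule power_mono) simp
  have s: "nstates M \<le> n ^ nstates M" using less_exp[of "nstates M"] base[of "nstates M"] by linarith
  have six: "6 \<le> n ^ 3" using base[of 3] by simp
  have n2: "n + 2 \<le> n ^ 2"
  proof -
    have "n + 2 \<le> 2 * n" using n by simp
    also have "\<dots> \<le> n * n" using n by (intro mult_right_mono) auto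
    finally show ?thesis by (simp add: power2_eq_square)
  qed
  have "2 * n \<le> n ^ 2" using n by (simp add: power2_eq_square)
  then have "2 ^ L \<le> n ^ 2" using log_ceiling_bounds(5)[OF n L] by simp
  then have "(2 ^ L) ^ k \<le> (n ^ 2) ^ k" by (rule power_mono) simp
  then have w: "2 ^ (k * L) \<le> n ^ (2 * k)" by (simp add: power_mult[symmetric] mult.commute)
  then have w1: "k * L + 1 \<le> n ^ (2 * k)" using less_exp[of "k * L"] by linarith
  have "1 \<le> n ^ k" using n by simp
  then have "n ^ k + 1 \<le> 2 * n ^ k" by simp
  also have "\<dots> \<le> n * n ^ k" using n by (intro mult_right_mono) auto
  finally have m: "n ^ k + 1 \<le> n ^ (k + 1)" by simp
  then have mD: "(n ^ k + 1) ^ D \<le> n ^ ((k + 1) * D)"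
    using power_mono[OF m, of D] by (simp only: power_mult)
  have "6 * (nstates M * ((n + 2) * (2 ^ (k * L) * ((k * L + 1) * (n ^ k + 1))))) * (n ^ k + 1) ^ D
     \<le> n ^ 3 * (n ^ nstates M * (n ^ 2 * (n ^ (2 * k) * (n ^ (2 * k) * n ^ (k + 1))))) * n ^ ((k + 1) * D)"
    by (intro mult_le_mono six s n2 w w1 m mD)
  also have "\<dots> = n ^ (nstates M + 5 * k + 6 + (k + 1) * D)"
    unfolding power_add[symmetric] by (rule arg_cong[of _ _ "\<lambda>i. n ^ i"]) simp
  finally have "6 * (nstates M * ((n + 2) * (2 ^ (k * L) * ((k * L + 1) * (n ^ k + 1))))) * (n ^ k + 1) ^ D * 2 ^ (n ^ k)
     \<le> n ^ (nstates M + 5 * k + 6 + (k + 1) * D) * 2 ^ (n ^ k)"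
    by (rule mult_le_mono1)
  then show ?thesis unfolding card_core_space by (simp only: mult_ac)
qed

text \<open>There are at most \<open>(n + 2) ^ (4 + a)\<close> rounds; one more exponent pays for
  the cells and \<open>12 * W\<close> for the constant factor.\<close>

lemma time_bound:
  fixes n a W :: nat
  assumes "m \<le> (n + 2) ^ 3 + n ^ a \<or> m \<le> 6"
  shows "m * ((n + 2) * (12 * W)) \<le> (n + 2) ^ (5 + a + 12 * W)"
proof -
  let ?b = "n + 2"
  have base: "2 ^ i \<le> ?b ^ i" for i :: nat by (rule power_mono) auto
  have "n ^ a \<le> ?b ^ a" by (rule power_mono) auto
  moreover have "?b ^ a \<le> ?b ^ (3 + a)" "?b ^ 3 \<le> ?b ^ (3 + a)" by (rule power_increasing; simp)+
  ultimately have "?b ^ 3 + n ^ a \<le> 2 * ?b ^ (3 + a)" by linarith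
  also have "\<dots> \<le> ?b * ?b ^ (3 + a)" by (rule mult_le_mono1) simp
  also have "?b * ?b ^ (3 + a) = ?b ^ (4 + a)" by (simp only: power_Suc[symmetric]) simp
  finally have "?b ^ 3 + n ^ a \<le> ?b ^ (4 + a)" .
  moreover have "(2 :: nat) ^ 3 \<le> ?b ^ (4 + a)"
    by (rule order_trans[OF base power_increasing]) simp_all
  moreover have "(2 :: nat) ^ 3 = 8" by simp
  ultimately have "m \<le> ?b ^ (4 + a)" using assms by linarith
  moreover have "12 * W \<le> ?b ^ (12 * W)" using less_exp[of "12 * W"] base[of "12 * W"] by linarith
  ultimately have "m * (?b * (12 * W)) \<le> ?b ^ (4 + a) * (?b ^ 1 * ?b ^ (12 * W))"
    by (intro mult_le_mono) auto
  also have "\<dots> = ?b ^ (5 + a + 12 * W)"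
    unfolding power_add[symmetric] by (rule arg_cong[of _ _ "\<lambda>i. ?b ^ i"]) simp
  finally show ?thesis .
qed

theorem theorem6p8:
  shows "AVG_tau_LCL \<subseteq> BPP"
proof
  fix A assume "A \<in> AVG_tau_LCL"
  then obtain k e M where wf: "wf_machine M"
    and dec: "\<And>x \<tau>. length \<tau> = length x ^ k \<Longrightarrow> halts M x (logbits k (length x)) \<tau> \<and>
        cout (final M x (logbits k (length x)) \<tau>) = [x \<in> A]"
    and avg: "\<And>x. (\<Sum>\<tau>\<in>{\<tau>. length \<tau> = length x ^ k}.
             real (hamming \<tau> (caux (final M x (logbits k (length x)) \<tau>))))
           / 2 ^ (length x ^ k) \<le> e"
    unfolding AVG_tau_LCL_def by blast
  define D where "D = nat \<lceil>6 * e\<rceil>"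
  have D: "6 * e \<le> real D" unfolding D_def by linarith
  \<comment> \<open>The exponent of \<open>slow_run_bound\<close>: with this many clock digits the
    time limit \<open>n ^ a\<close> cuts off at most a sixth of the tapes as close but slow.\<close>
  define a where "a = nstates M + 5 * k + 6 + (k + 1) * D"
  interpret simulation M k a "\<lambda>x. x \<in> A" by unfold_locales (rule wf)
  define W where "W = 10 + 2 * k + a"
  obtain M' where M': "wf_machine M'" and M'_run: "\<And>x wl aux t q c aux' ah out.
      (length x + 2) * (2 * W) \<le> wl \<Longrightarrow> (sweep_round x ^^ t) (init_sweep aux) = (q, c, aux', ah, out) \<Longrightarrow>
      prog_hlt q \<Longrightarrow>
      halting M' (cstate (run M' x wl aux (t * ((length x + 2) * (12 * W))))) \<and>
      cout (run M' x wl aux (t * ((length x + 2) * (12 * W)))) = out"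
    using sweep_automaton_machine unfolding W_def by metis
  define c where "c = 5 + a + 12 * W"
  let ?T = "\<lambda>x :: bool list. (length x + 2) ^ c"
  have finish: "halts_within M' x (?T x) r (?T x) \<and> cout (final M' x (?T x) r) = out"
    if "reach x b (init_sweep r) (q, cc, aux', ah, out)" "prog_hlt q"
      "b = (length x + 2) ^ 3 + length x ^ a \<or> b = 6" for x r b q cc aux' ah out
  proof -
    have "\<exists>m\<le>b. (sweep_round x ^^ m) (init_sweep r) = (q, cc, aux', ah, out)"
      using that(1) unfolding reach_def .
    then obtain m where m: "m \<le> b" "(sweep_round x ^^ m) (init_sweep r) = (q, cc, aux', ah, out)"
      by blast
    let ?t = "m * ((length x + 2) * (12 * W))"
    \<comment> \<open>The time bound for a single round doubles as the space bound, because the work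
      tape is as long as the time limit.\<close>
    have "(length x + 2) * (2 * W) \<le> 1 * ((length x + 2) * (12 * W))" by simp
    also have "\<dots> \<le> ?T x" unfolding c_def by (rule time_bound) simp
    finally have "halting M' (cstate (run M' x (?T x) r ?t)) \<and> cout (run M' x (?T x) r ?t) = out"
      using M'_run m(2) that(2) by blast
    moreover have "?t \<le> ?T x" unfolding c_def by (rule time_bound) (use m(1) that(3) in auto)
    ultimately show ?thesis using final_eq_run by (auto simp: halts_within_def)
  qed
  have small: "halts_within M' x (?T x) r (?T x) \<and> cout (final M' x (?T x) r) = [x \<in> A]"
    if x: "length x < 2" for x r
  proof -
    obtain cc ah where "reach x 6 (init_sweep r) (Halt, cc, r, ah, [x \<in> A])"
      using reach_answer[OF x] by blast
    then show ?thesis by (rule finish) (auto simp: prog_hlt_def)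
  qed
  have large: "halts_within M' x (?T x) r (?T x) \<and>
      (halt_time M x (logbits k (length x)) (take (length x ^ k) r) < length x ^ a \<longrightarrow>
       cout (final M' x (?T x) r) = [x \<in> A])"
    if n: "2 \<le> length x" and r: "length x ^ k \<le> length r" for x r
  proof -
    let ?\<tau> = "take (length x ^ k) r"
    define L where "L = nat \<lceil>log 2 (real (length x))\<rceil>"
    have lb: "logbits k (length x) = k * L" using n by (simp add: logbits_def L_def max_absorb1)
    have "halts M x (k * L) ?\<tau> \<and> cout (final M x (k * L) ?\<tau>) = [x \<in> A]"
      using dec[of ?\<tau> x] r lb by simp
    moreover obtain q cc aux ah out where
      "reach x ((length x + 2) ^ 3 + length x ^ a) (init_sweep r) (q, cc, aux, ah, out)" "prog_hlt q"
      "halts M x (k * L) ?\<tau> \<and> halt_time M x (k * L) ?\<tau> < length x ^ a \<longrightarrow>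
        out = cout (final M x (k * L) ?\<tau>)"
      using simulation_outcome[OF n L_def r] by blast
    ultimately show ?thesis using finish lb by metis
  qed
  \<comment> \<open>The random tape must have room for a full catalytic tape;
    \<open>c \<ge> k\<close> ensures it.\<close>
  have kT: "length x ^ k \<le> ?T x" for x :: "bool list"
  proof -
    have "length x ^ k \<le> (length x + 2) ^ k" by (rule power_mono) auto
    also have "\<dots> \<le> ?T x" by (rule power_increasing) (auto simp: c_def a_def)
    finally show ?thesis .
  qed
  have halt: "halts_within M' x (?T x) r (?T x)" if "length r = ?T x" for x r
    using small[of x r] large[of x r] kT[of x] that by (cases "length x < 2") auto
  have prob: "2 / 3 * 2 ^ ?T x \<le> real (card {r. length r = ?T x \<and> cout (final M' x (?T x) r) = [x \<in> A]})"
    for x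
  proof (cases "length x < 2")
    case True
    then have "{r. length r = ?T x \<and> cout (final M' x (?T x) r) = [x \<in> A]} = {r. length r = ?T x}"
      using small by auto
    then show ?thesis by (simp add: card_bool_lists)
  next
    case False
    then have n: "2 \<le> length x" by simp
    let ?m = "length x ^ k"
    define L where "L = nat \<lceil>log 2 (real (length x))\<rceil>"
    have lb: "logbits k (length x) = k * L" using n by (simp add: logbits_def L_def max_absorb1)
    let ?S = "{\<tau>. length \<tau> = ?m \<and> halt_time M x (k * L) \<tau> < length x ^ a}"
    have "2 / 3 * 2 ^ ?m \<le> real (card ?S)"
    proof (rule card_fast_runs[OF wf])
      show "halts M x (k * L) \<tau>" if "length \<tau> = ?m" for \<tau> using dec[OF that] lb by simp
      show "6 * card (core_space M (length x) (k * L) ?m) * (?m + 1) ^ D \<le> length x ^ a * 2 ^ ?m"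
        unfolding a_def by (rule slow_run_bound[OF n L_def])
    qed (use avg[of x] lb D n in auto)
    then have "2 / 3 * 2 ^ ?m * 2 ^ (?T x - ?m) \<le> real (card ?S) * 2 ^ (?T x - ?m)"
      by (rule mult_right_mono) simp
    moreover have "(2 :: real) ^ ?m * 2 ^ (?T x - ?m) = 2 ^ ?T x"
      using kT[of x] by (simp add: power_add[symmetric])
    ultimately have "2 / 3 * 2 ^ ?T x \<le> real (card ?S * 2 ^ (?T x - ?m))"
      by (simp only: mult.assoc of_nat_mult of_nat_power of_nat_numeral)
    also have "\<dots> = real (card {r. length r = ?T x \<and> take ?m r \<in> ?S})"
      using kT[of x] by (subst card_prefix) auto
    also have "\<dots> \<le> real (card {r. length r = ?T x \<and> cout (final M' x (?T x) r) = [x \<in> A]})"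
    proof (intro of_nat_mono card_mono)
      show "finite {r. length r = ?T x \<and> cout (final M' x (?T x) r) = [x \<in> A]}"
        by (rule finite_subset[OF _ finite_bool_lists[of "?T x"]]) auto
    qed (use large[OF n] kT[of x] lb in auto)
    finally show ?thesis .
  qed
  show "A \<in> BPP" unfolding BPP_def
    using M' halt prob by blast
qed

end
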